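(* Assume (H0), (H0'), (H1), (H2), and let $2\le p\le\infty$. Let $f\in L^p(\Omega)$ and let $u\in\mathcal{H}_{J,0}(\Omega)$ be the weak solution of $\mathfrak{L}u=f$ in $\Omega$, $u=0$ in $\Omega^c$. Then $\|u\|_{L^p(\Omega)}\le C\|f\|_{L^p(\Omega)}$ with $C$ depending only on the kernel $J$ and on $\Omega$.
   Context: Standing setting: $N\ge1$, $\Omega\subset\mathbb{R}^N$ bounded open, $B_\varepsilon=\{|z|<\varepsilon\}$. (H0): $J:\mathbb{R}^N\times\mathbb{R}^N\to[0,\infty)$ measurable, symmetric, $\sup_x\int\min(1,|x-y|^2)J(x,y)\,dy<\infty$. (H0'): $J(x,y)\ge\mathcal{K}(x-y)\ge0$ with $\mathcal{K}\notin L^1(B_\varepsilon)$ for all $\varepsilon>0$. (H1): there exist $\rho>0$ and $\ell:(0,\rho)\to(0,\infty)$, bounded above and below by positive constants on $[\varepsilon,\rho)$ for every $\varepsilon\in(0,\rho)$, with $\mathcal{K}(z)=|z|^{-N}\ell(|z|)$ for $0<|z|<\rho$ and $M(r):=\int_r^\rho\ell(s)/s\,ds\to\infty$ as $r\to0^+$. (H2): $\lim_{s\to0^+}\ell(\lambda s)/\ell(s)=1$ for all $\lambda>0$. $Q_\Omega=(\Omega^c\times\Omega^c)^c$, $\mathcal{E}(u,v)=\frac12\iint_{Q_\Omega}(u(x)-u(y))(v(x)-v(y))J(x,y)\,dx\,dy$; $\mathcal{H}_{J,0}(\Omega)$ is the set of measurable $u$ with $u|_\Omega\in L^2(\Omega)$,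 $\mathcal{E}(u,u)<\infty$, $u=0$ a.e. on $\Omega^c$. A weak solution of $\mathfrak{L}u=f$ in $\Omega$, $u=0$ in $\Omega^c$ is $u\in\mathcal{H}_{J,0}(\Omega)$ with $\mathcal{E}(u,\phi)=\int_\Omega f\phi$ for all $\phi\in\mathcal{H}_{J,0}(\Omega)$ (it exists and is unique). *)

theory Defs
  imports "HOL-Analysis.Analysis"
begin

definition Q_set :: "'n::euclidean_space set \<Rightarrow> ('n \<times> 'n) set" where
  "Q_set \<Omega> = UNIV - ((- \<Omega>) \<times> (- \<Omega>))"

definition energy_form ::
  "('n::euclidean_space \<Rightarrow> 'n \<Rightarrow> real) \<Rightarrow> 'n set \<Rightarrow> ('n \<Rightarrow> real) \<Rightarrow> ('n \<Rightarrow> real) \<Rightarrow> real" where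
  "energy_form J \<Omega> u v = 1/2 * (\<integral> w. indicator (Q_set \<Omega>) w *
       ((u (fst w) - u (snd w)) * (v (fst w) - v (snd w)) * J (fst w) (snd w))
       \<partial>(lebesgue \<Otimes>\<^sub>M lebesgue))"

text \<open>E(u,u) as a nonnegative extended real (to express finiteness).\<close>
definition energy_nn ::
  "('n::euclidean_space \<Rightarrow> 'n \<Rightarrow> real) \<Rightarrow> 'n set \<Rightarrow> ('n \<Rightarrow> real) \<Rightarrow> ennreal" where
  "energy_nn J \<Omega> u = (\<integral>\<^sup>+ w. indicator (Q_set \<Omega>) w *
       ennreal (1/2 * (u (fst w) - u (snd w))^2 * J (fst w) (snd w))
       \<partial>(lebesgue \<Otimes>\<^sub>M lebesgue))"

definition H_J0 :: "('n::euclidean_space \<Rightarrow> 'n \<Rightarrow> real) \<Rightarrow> 'n set \<Rightarrow> ('n \<Rightarrow> real) set" where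
  "H_J0 J \<Omega> = {u. u \<in> borel_measurable lebesgue
      \<and> (\<integral>\<^sup>+ x\<in>\<Omega>. ennreal ((u x)^2) \<partial>lebesgue) < \<infinity>
      \<and> energy_nn J \<Omega> u < \<infinity>
      \<and> (AE x in lebesgue. x \<notin> \<Omega> \<longrightarrow> u x = 0)}"

definition weak_solution ::
  "('n::euclidean_space \<Rightarrow> 'n \<Rightarrow> real) \<Rightarrow> 'n set \<Rightarrow> ('n \<Rightarrow> real) \<Rightarrow> ('n \<Rightarrow> real) \<Rightarrow> bool" where
  "weak_solution J \<Omega> f u \<longleftrightarrow> u \<in> H_J0 J \<Omega> \<and>
     (\<forall>\<phi>\<in>H_J0 J \<Omega>. energy_form J \<Omega> u \<phi> = (LINT x:\<Omega>|lebesgue. f x * \<phi> x))"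

definition Lp_norm :: "'n::euclidean_space set \<Rightarrow> ennreal \<Rightarrow> ('n \<Rightarrow> real) \<Rightarrow> ennreal" where
  "Lp_norm \<Omega> p f =
     (if p = \<infinity> then (INF C \<in> {C::ennreal. AE x in lebesgue. x \<in> \<Omega> \<longrightarrow> ennreal \<bar>f x\<bar> \<le> C}. C)
      else (let I = (\<integral>\<^sup>+ x\<in>\<Omega>. ennreal (\<bar>f x\<bar> powr enn2real p) \<partial>lebesgue)
            in if I = \<infinity> then \<infinity> else ennreal (enn2real I powr (1 / enn2real p))))"

definition in_Lp :: "'n::euclidean_space set \<Rightarrow> ennreal \<Rightarrow> ('n \<Rightarrow> real) \<Rightarrow> bool" where
  "in_Lp \<Omega> p f \<longleftrightarrow> set_borel_measurable lebesgue \<Omega> f \<and> Lp_norm \<Omega> p f < \<infinity>"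

end

(* Only two facts about the kernel matter: J is nonnegative, and it is bounded below by a constant
   c0 > 0 on pairs with y - x in a ball S that avoids the origin.  Iterating translations by z in S
   until Omega has left itself turns this into a Poincare inequality, hence an L^2 bound on u.  So at
   a level h comparable to the norm F of f, the set {u > h} has at most half the measure of S, and
   every x sees a fixed amount of J-mass on {u <= h}.  Testing with g(u), g monotone and vanishing
   below h, then gives

     kappa * int (u - h)^+ g(u) <= E(u, g(u)) = int f g(u)

   with kappa independent of g.  The choice g(t) = ((t - h)^+)^(p-1), truncated, bounds the L^p norm
   of (u - h)^+ by 2 F / kappa uniformly in p, without interpolation; g(t) = (t - h - F/kappa)^+ gives
   the case p = infinity.  The same applied to -u concludes. *)
theory Submission
  imports Defs
begin

text \<open>The difficulty is a constant that does not deteriorate as p grows. Testing with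
  |u|^(p-2) u and bounding the energy below by a quadratic form in |u|^(p/2) loses a factor of order
  1/p. Here no two powers are compared: on a pair with u(y) <= h < u(x) the term g(u(y)) vanishes,
  so the integrand is at least \<open>c\<^sub>0\<close> (u(x) - h) g(u(x)), which is linear in g,
  and every other pair contributes nonnegatively because g is monotone. The price is the range |u|
  <= 2h, which costs a multiple of F on a set of finite measure. The L^2 bound enters once, through
  Chebyshev's inequality, to fix the level; it serves every p >= 2 because Omega has finite measure.
  Truncation makes g Lipschitz, so that g(u) is an admissible test function, and makes the quantity
  to be absorbed finite. All p-dependent factors are p-th powers of fixed constants or are dominated
  by such powers, so they stay bounded under the p-th root.\<close>

section \<open>Tonelli, translation and measurability on the product of Lebesgue measures\<close>

lemma sigma_finite_completion:
  assumes "sigma_finite_measure M"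
  shows "sigma_finite_measure (completion M)"
proof -
  interpret sigma_finite_measure M by fact
  obtain A where A: "countable A" "A \<subseteq> sets M" "\<Union>A = space M" "\<forall>a\<in>A. emeasure M a \<noteq> \<infinity>"
    using sigma_finite_countable by blast
  show ?thesis
    by standard (use A in \<open>auto intro!: exI[of _ A]\<close>)
qed

text \<open>This gives Tonelli's theorem for \<open>lebesgue \<Otimes>\<^sub>M lebesgue\<close>, the
  measure over which the energy is defined.\<close>

interpretation lebesgue: sigma_finite_measure "lebesgue :: 'n::euclidean_space measure"
  by (rule sigma_finite_completion) (rule sigma_finite_lborel)

lemma nn_integral_lborel_translate:
  fixes f :: "'n::euclidean_space \<Rightarrow> ennreal"
  assumes [measurable]: "f \<in> borel_measurable borel"
  shows "(\<integral>\<^sup>+x. f (t + x) \<partial>lborel) = (\<integral>\<^sup>+x. f x \<partial>lborel)"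
proof -
  have "(\<integral>\<^sup>+x. f x \<partial>lborel) = (\<integral>\<^sup>+x. f x \<partial>distr lborel borel ((+) t))"
    by (simp only: lborel_distr_plus)
  also have "\<dots> = (\<integral>\<^sup>+x. f (t + x) \<partial>lborel)"
    by (subst nn_integral_distr) auto
  finally show ?thesis by simp
qed

lemma measurable_lebesgue_fst:
  assumes "u \<in> borel_measurable lebesgue"
  shows "(\<lambda>w. u (fst w)) \<in> borel_measurable (lebesgue \<Otimes>\<^sub>M lebesgue)"
  using measurable_compose[OF measurable_fst assms] .

lemma measurable_lebesgue_snd:
  assumes "u \<in> borel_measurable lebesgue"
  shows "(\<lambda>w. u (snd w)) \<in> borel_measurable (lebesgue \<Otimes>\<^sub>M lebesgue)"
  using measurable_compose[OF measurable_snd assms] .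

lemma id_measurable_lebesgue: "(\<lambda>x::'n::euclidean_space. x) \<in> borel_measurable lebesgue"
  by (rule measurable_completion) simp

lemma Q_set_measurable:
  assumes "open \<Omega>"
  shows "Q_set \<Omega> \<in> sets (lebesgue \<Otimes>\<^sub>M lebesgue)"
proof -
  have "- \<Omega> \<in> sets lebesgue"
    using assms by (simp add: borel_closed closed_Compl sets_completionI_sets)
  then have "space (lebesgue \<Otimes>\<^sub>M lebesgue) - (- \<Omega>) \<times> (- \<Omega>) \<in> sets (lebesgue \<Otimes>\<^sub>M lebesgue)"
    by (intro sets.compl_sets pair_measureI)
  then show ?thesis
    by (simp add: Q_set_def space_pair_measure)
qed

section \<open>The energy form of a kernel bounded below on a ball of displacements\<close>

text \<open>The condition \<open>r_less\<close> gives every admissible displacement length at least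
  \<open>norm z\<^sub>0 - r\<close> > 0, so that a fixed number of repetitions carries any point of
  the bounded set out of it.\<close>

locale kernel_bounded_below =
  fixes J :: "'n::euclidean_space \<Rightarrow> 'n \<Rightarrow> real" and \<Omega> :: "'n set"
    and c\<^sub>0 :: real and z\<^sub>0 :: 'n and r :: real
  assumes \<Omega>_open: "open \<Omega>" and \<Omega>_bdd: "bounded \<Omega>"
    and J_meas: "(\<lambda>w. J (fst w) (snd w)) \<in> borel_measurable (lebesgue \<Otimes>\<^sub>M lebesgue)"
    and J_nonneg: "J x y \<ge> 0"
    and J_lower: "y - x \<in> ball z\<^sub>0 r \<Longrightarrow> c\<^sub>0 \<le> J x y"
    and c\<^sub>0_pos: "c\<^sub>0 > 0" and r_pos: "r > 0" and r_less: "r < norm z\<^sub>0"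
begin

definition V :: real where "V = measure lebesgue (ball (0::'n) r)"

lemma V_pos: "V > 0"
  unfolding V_def using r_pos by (simp add: content_ball_pos)

lemma emeasure_ball_V: "emeasure lebesgue (ball (x::'n) r) = ennreal V"
  unfolding V_def using r_pos by (simp add: emeasure_ball content_ball)

definition dens :: "('n \<Rightarrow> real) \<Rightarrow> ('n \<Rightarrow> real) \<Rightarrow> 'n \<times> 'n \<Rightarrow> real" where
  "dens u v w = indicator (Q_set \<Omega>) w * ((u (fst w) - u (snd w)) * (v (fst w) - v (snd w)) * J (fst w) (snd w))"

lemma \<Omega>_sets: "\<Omega> \<in> sets lebesgue"
  using \<Omega>_open by (simp add: borel_open sets_completionI_sets)

lemma dens_measurable:
  assumes "u \<in> borel_measurable lebesgue" "v \<in> borel_measurable lebesgue"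
  shows "dens u v \<in> borel_measurable (lebesgue \<Otimes>\<^sub>M lebesgue)"
proof -
  note [measurable] = measurable_lebesgue_fst[OF assms(1)] measurable_lebesgue_snd[OF assms(1)]
    measurable_lebesgue_fst[OF assms(2)] measurable_lebesgue_snd[OF assms(2)] J_meas
    Q_set_measurable[OF \<Omega>_open]
  show ?thesis unfolding dens_def by measurable
qed

lemma energy_form_dens: "energy_form J \<Omega> u v = 1/2 * (\<integral>w. dens u v w \<partial>(lebesgue \<Otimes>\<^sub>M lebesgue))"
  unfolding energy_form_def dens_def ..

lemma energy_nn_dens:
  "energy_nn J \<Omega> u = (\<integral>\<^sup>+w. ennreal (1/2 * dens u u w) \<partial>(lebesgue \<Otimes>\<^sub>M lebesgue))"
  unfolding energy_nn_def dens_def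
  by (intro nn_integral_cong) (auto simp: indicator_def power2_eq_square)

lemma H_J0_measurable: "u \<in> H_J0 J \<Omega> \<Longrightarrow> u \<in> borel_measurable lebesgue"
  by (simp add: H_J0_def)

lemma H_J0_AE: "u \<in> H_J0 J \<Omega> \<Longrightarrow> AE x in lebesgue. x \<notin> \<Omega> \<longrightarrow> u x = 0"
  by (simp add: H_J0_def)

lemma dens_nonneg: "dens u u w \<ge> 0"
  unfolding dens_def using J_nonneg by (simp add: power2_eq_square[symmetric])

lemma integrable_dens_self:
  assumes "u \<in> H_J0 J \<Omega>"
  shows "integrable (lebesgue \<Otimes>\<^sub>M lebesgue) (dens u u)"
proof -
  have m: "dens u u \<in> borel_measurable (lebesgue \<Otimes>\<^sub>M lebesgue)"
    using assms by (intro dens_measurable H_J0_measurable)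
  have "integrable (lebesgue \<Otimes>\<^sub>M lebesgue) (\<lambda>w. 1/2 * dens u u w)"
  proof (rule integrableI_nonneg)
    show "(\<integral>\<^sup>+w. ennreal (1/2 * dens u u w) \<partial>(lebesgue \<Otimes>\<^sub>M lebesgue)) < \<infinity>"
      using assms unfolding energy_nn_dens[symmetric] by (simp add: H_J0_def)
  qed (use m dens_nonneg in auto)
  from integrable_mult_right[OF this, of 2] show ?thesis by simp
qed

text \<open>Young's inequality |a b| <= a^2 + b^2, weighted by \<open>J\<close>, bounds the mixed
  density by the two diagonal ones. Without integrability the Bochner integral in
  \<open>energy_form\<close> would be a default value.\<close>

lemma integrable_dens:
  assumes "u \<in> H_J0 J \<Omega>" "v \<in> H_J0 J \<Omega>"
  shows "integrable (lebesgue \<Otimes>\<^sub>M lebesgue) (dens u v)"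
proof (rule Bochner_Integration.integrable_bound)
  show "integrable (lebesgue \<Otimes>\<^sub>M lebesgue) (\<lambda>w. dens u u w + dens v v w)"
    using assms by (intro Bochner_Integration.integrable_add integrable_dens_self)
  show "dens u v \<in> borel_measurable (lebesgue \<Otimes>\<^sub>M lebesgue)"
    using assms by (intro dens_measurable H_J0_measurable)
  show "AE w in lebesgue \<Otimes>\<^sub>M lebesgue. norm (dens u v w) \<le> norm (dens u u w + dens v v w)"
  proof (rule AE_I2)
    fix w :: "'n \<times> 'n"
    define a b where "a = u (fst w) - u (snd w)" "b = v (fst w) - v (snd w)"
    have "2 * (\<bar>a\<bar> * \<bar>b\<bar>) \<le> a * a + b * b"
      using sum_squares_bound[of "\<bar>a\<bar>" "\<bar>b\<bar>"] by (simp add: power2_eq_square)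
    then have "\<bar>a\<bar> * \<bar>b\<bar> \<le> a * a + b * b"
      using mult_nonneg_nonneg[OF abs_ge_zero[of a] abs_ge_zero[of b]] by linarith
    then have "\<bar>a * b\<bar> * J (fst w) (snd w) \<le> (a * a + b * b) * J (fst w) (snd w)"
      using J_nonneg by (intro mult_right_mono) (simp_all add: abs_mult)
    then have "\<bar>a * b * J (fst w) (snd w)\<bar> \<le> a * a * J (fst w) (snd w) + b * b * J (fst w) (snd w)"
      using J_nonneg[of "fst w" "snd w"] by (simp add: abs_mult distrib_right)
    moreover have "dens u u w + dens v v w \<ge> 0"
      using dens_nonneg by (intro add_nonneg_nonneg)
    ultimately show "norm (dens u v w) \<le> norm (dens u u w + dens v v w)"
      by (auto simp: dens_def a_b_def indicator_def)
  qed
qed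

lemma energy_form_eq_nn_integral:
  assumes "u \<in> H_J0 J \<Omega>" "v \<in> H_J0 J \<Omega>" "\<And>w. dens u v w \<ge> 0"
  shows "ennreal (energy_form J \<Omega> u v) = (\<integral>\<^sup>+w. ennreal (1/2 * dens u v w) \<partial>(lebesgue \<Otimes>\<^sub>M lebesgue))"
  using integrable_dens[OF assms(1,2)] assms(3)
  by (subst nn_integral_eq_integral) (auto simp: energy_form_dens)

lemma energy_form_self: "u \<in> H_J0 J \<Omega> \<Longrightarrow> ennreal (energy_form J \<Omega> u u) = energy_nn J \<Omega> u"
  using dens_nonneg energy_form_eq_nn_integral energy_nn_dens by metis

text \<open>Composition with g scales increments by at most L, hence the energy by at most L^2, and
  g(0) = 0 preserves the exterior condition. This is what makes g(u) admissible in the weak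
  formulation.\<close>

lemma H_J0_comp_Lipschitz:
  assumes u: "u \<in> H_J0 J \<Omega>" and g: "\<And>s t. \<bar>g s - g t\<bar> \<le> L * \<bar>s - t\<bar>" and g0: "g 0 = (0::real)"
  shows "(\<lambda>x. g (u x)) \<in> H_J0 J \<Omega>"
proof -
  have "L \<ge> 0" using g[of 1 0] by simp
  then have "L-lipschitz_on UNIV g"
    using g by (auto intro!: lipschitz_onI simp: dist_real_def)
  then have "g \<in> borel_measurable borel"
    by (intro borel_measurable_continuous_onI lipschitz_on_continuous_on)
  then have m: "(\<lambda>x. g (u x)) \<in> borel_measurable lebesgue"
    using H_J0_measurable[OF u] by measurable
  have sq: "(g s - g t)\<^sup>2 \<le> L\<^sup>2 * (s - t)\<^sup>2" for s t
    using power_mono[OF g[of s t], of 2] by (simp add: power_mult_distrib)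
  note [measurable] = H_J0_measurable[OF u] \<Omega>_sets
  have "(\<integral>\<^sup>+x\<in>\<Omega>. ennreal ((g (u x))\<^sup>2) \<partial>lebesgue) \<le> (\<integral>\<^sup>+x. ennreal (L\<^sup>2) * (ennreal ((u x)\<^sup>2) * indicator \<Omega> x) \<partial>lebesgue)"
    using sq[of _ 0] g0
    by (intro nn_integral_mono) (auto simp: indicator_def ennreal_mult[symmetric] intro!: ennreal_leI)
  also have "\<dots> = ennreal (L\<^sup>2) * (\<integral>\<^sup>+x\<in>\<Omega>. ennreal ((u x)\<^sup>2) \<partial>lebesgue)"
    by (intro nn_integral_cmult) measurable
  also have "\<dots> < \<infinity>"
    using u by (auto simp: H_J0_def ennreal_mult_less_top)
  finally have l2: "(\<integral>\<^sup>+x\<in>\<Omega>. ennreal ((g (u x))\<^sup>2) \<partial>lebesgue) < \<infinity>" .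
  have "energy_nn J \<Omega> (\<lambda>x. g (u x)) \<le> (\<integral>\<^sup>+w. ennreal (L\<^sup>2) * ennreal (1/2 * dens u u w) \<partial>(lebesgue \<Otimes>\<^sub>M lebesgue))"
    unfolding energy_nn_dens
  proof (intro nn_integral_mono)
    fix w :: "'n \<times> 'n"
    have "dens (\<lambda>x. g (u x)) (\<lambda>x. g (u x)) w \<le> L\<^sup>2 * dens u u w"
      unfolding dens_def using mult_right_mono[OF sq J_nonneg, of "u (fst w)" "u (snd w)" "fst w" "snd w"]
      by (auto simp: indicator_def power2_eq_square)
    then have "ennreal (1/2 * dens (\<lambda>x. g (u x)) (\<lambda>x. g (u x)) w) \<le> ennreal (L\<^sup>2 * (1/2 * dens u u w))"
      by (intro ennreal_leI) auto
    then show "ennreal (1/2 * dens (\<lambda>x. g (u x)) (\<lambda>x. g (u x)) w) \<le> ennreal (L\<^sup>2) * ennreal (1/2 * dens u u w)"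
      using dens_nonneg[of u w] by (simp only: ennreal_mult[symmetric] zero_le_power2 mult_nonneg_nonneg divide_nonneg_nonneg zero_le_one zero_le_numeral)
  qed
  also have "\<dots> = ennreal (L\<^sup>2) * energy_nn J \<Omega> u"
    unfolding energy_nn_dens using dens_measurable[of u u] by (intro nn_integral_cmult) auto
  also have "\<dots> < \<infinity>"
    using u by (auto simp: H_J0_def ennreal_mult_less_top)
  finally have "energy_nn J \<Omega> (\<lambda>x. g (u x)) < \<infinity>" .
  moreover have "AE x in lebesgue. x \<notin> \<Omega> \<longrightarrow> g (u x) = 0"
    using H_J0_AE[OF u] g0 by auto
  ultimately show ?thesis
    using m l2 by (simp add: H_J0_def)
qed

text \<open>The bound is stated in [0, \<infinity>], so that later estimates can proceed with
  nonnegative integrals only.\<close>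

lemma energy_le_source:
  assumes "weak_solution J \<Omega> f u" "\<phi> \<in> H_J0 J \<Omega>"
  shows "ennreal (energy_form J \<Omega> u \<phi>) \<le> (\<integral>\<^sup>+x\<in>\<Omega>. ennreal (\<bar>f x\<bar> * \<bar>\<phi> x\<bar>) \<partial>lebesgue)"
proof -
  let ?h = "\<lambda>x. indicator \<Omega> x * (f x * \<phi> x)"
  have eq: "energy_form J \<Omega> u \<phi> = (\<integral>x. ?h x \<partial>lebesgue)"
    using assms by (simp add: weak_solution_def set_lebesgue_integral_def)
  show ?thesis
  proof (cases "integrable lebesgue ?h")
    case True
    have "ennreal (energy_form J \<Omega> u \<phi>) \<le> ennreal (norm (\<integral>x. ?h x \<partial>lebesgue))"
      unfolding eq by (intro ennreal_leI) simp
    also have "\<dots> \<le> (\<integral>\<^sup>+x. ennreal (norm (?h x)) \<partial>lebesgue)"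
      by (rule integral_norm_bound_ennreal[OF True])
    also have "\<dots> = (\<integral>\<^sup>+x\<in>\<Omega>. ennreal (\<bar>f x\<bar> * \<bar>\<phi> x\<bar>) \<partial>lebesgue)"
      by (intro nn_integral_cong) (auto simp: indicator_def abs_mult)
    finally show ?thesis .
  next
    \<comment> \<open>The Bochner integral now has its default value 0, hence so has the energy, and
      the bound is trivial.\<close>
    case False
    then show ?thesis unfolding eq by (simp add: not_integrable_integral_eq)
  qed
qed

section \<open>Coercivity above a level\<close>

text \<open>Of the ball of volume V around x + \<open>z\<^sub>0\<close>, at least V/2 lies in {u <=
  h}. A partner y there has g(u(y)) = 0 and u(x) - u(y) >= u(x) - h. The constant is
  \<open>c\<^sub>0\<close> times the prefactor 1/2 of the form times V/2.\<close>

lemma level_estimate: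
  assumes u: "u \<in> H_J0 J \<Omega>" and g: "\<And>s t. \<bar>g s - g t\<bar> \<le> L * \<bar>s - t\<bar>" and mono: "mono g"
    and g0: "\<And>t. t \<le> h \<Longrightarrow> g t = 0" and h: "h \<ge> 0"
    and small: "emeasure lebesgue {x. h < u x} \<le> ennreal (V/2)"
  shows "(\<integral>\<^sup>+x. ennreal (c\<^sub>0 * V / 4 * (max 0 (u x - h) * g (u x))) \<partial>lebesgue)
    \<le> ennreal (energy_form J \<Omega> u (\<lambda>x. g (u x)))"
proof -
  note u_meas[measurable] = H_J0_measurable[OF u]
  \<comment> \<open>Compare t with a point at or below h, where g vanishes.\<close>
  have gnn: "g t \<ge> 0" for t
    using monoD[OF mono, of "min t h" t] g0[of "min t h"] by simp
  have "L \<ge> 0" using g[of 1 0] by simp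
  then have "L-lipschitz_on UNIV g"
    using g by (auto intro!: lipschitz_onI simp: dist_real_def)
  then have g_meas[measurable]: "g \<in> borel_measurable borel"
    by (intro borel_measurable_continuous_onI lipschitz_on_continuous_on)
  have phi: "(\<lambda>x. g (u x)) \<in> H_J0 J \<Omega>"
    using H_J0_comp_Lipschitz[OF u g] g0 h by auto
  have mono2: "(s - t) * (g s - g t) \<ge> 0" for s t
    using monoD[OF mono, of s t] monoD[OF mono, of t s]
    by (cases "s \<le> t") (auto intro: mult_nonneg_nonneg mult_nonpos_nonpos)
  have nn: "dens u (\<lambda>x. g (u x)) w \<ge> 0" for w
    unfolding dens_def by (intro mult_nonneg_nonneg J_nonneg mono2) auto
  \<comment> \<open>No condition u(x) > h is put into T, since the weight \<open>a\<close> vanishes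
    when u(x) <= h. This keeps the slices over every x in Omega large.\<close>
  define T where "T = {w. fst w \<in> \<Omega> \<and> u (snd w) \<le> h \<and> snd w - fst w \<in> ball z\<^sub>0 r}"
  define a where "a x = c\<^sub>0 / 2 * (max 0 (u x - h) * g (u x))" for x
  have a_nn: "a x \<ge> 0" for x unfolding a_def using gnn c\<^sub>0_pos by simp
  have [measurable]: "a \<in> borel_measurable lebesgue"
    unfolding a_def by measurable
  have a_fst[measurable]: "(\<lambda>w. ennreal (a (fst w))) \<in> borel_measurable (lebesgue \<Otimes>\<^sub>M lebesgue)"
    by (intro measurable_compose[OF measurable_lebesgue_fst measurable_ennreal]) fact
  note [measurable] = measurable_lebesgue_fst[OF u_meas] measurable_lebesgue_snd[OF u_meas]
    measurable_lebesgue_fst[OF id_measurable_lebesgue] measurable_lebesgue_snd[OF id_measurable_lebesgue]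
  have "T = {w \<in> space (lebesgue \<Otimes>\<^sub>M lebesgue). fst w \<in> \<Omega> \<and> u (snd w) \<le> h \<and> snd w - fst w \<in> ball z\<^sub>0 r}"
    by (auto simp: T_def space_pair_measure)
  also have "\<dots> \<in> sets (lebesgue \<Otimes>\<^sub>M lebesgue)"
    using measurable_sets[OF measurable_fst \<Omega>_sets, of lebesgue]
    by (intro sets.sets_Collect_conj) (auto simp: vimage_def Collect_conj_eq Int_commute)
  finally have T_meas[measurable]: "T \<in> sets (lebesgue \<Otimes>\<^sub>M lebesgue)" .
  have slice: "ennreal (V/2) \<le> emeasure lebesgue {y. (x, y) \<in> T}" if "x \<in> \<Omega>" for x
  proof -
    have A: "{x. h < u x} \<in> sets lebesgue"
      using u_meas by (simp add: borel_measurable_iff_greater)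
    have "{y. (x, y) \<in> T} = ball (x + z\<^sub>0) r - {x. h < u x}"
      using that by (auto simp: T_def dist_norm algebra_simps)
    moreover have "emeasure lebesgue (ball (x + z\<^sub>0) r) \<le>
        emeasure lebesgue (ball (x + z\<^sub>0) r - {x. h < u x}) + emeasure lebesgue {x. h < u x}"
      using A by (intro order_trans[OF emeasure_mono emeasure_subadditive]) (auto simp: sets_completionI_sets)
    ultimately have "ennreal V \<le> emeasure lebesgue {y. (x, y) \<in> T} + ennreal (V/2)"
      using small emeasure_ball_V by (metis add_left_mono order_trans)
    then have "ennreal (V/2) + ennreal (V/2) \<le> ennreal (V/2) + emeasure lebesgue {y. (x, y) \<in> T}"
      using V_pos by (simp add: ennreal_plus[symmetric] add.commute del: ennreal_plus)
    then show ?thesis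
      by (simp add: ennreal_add_left_cancel_le)
  qed
  have "(\<integral>\<^sup>+x. ennreal (c\<^sub>0 * V / 4 * (max 0 (u x - h) * g (u x))) \<partial>lebesgue)
     = (\<integral>\<^sup>+x. ennreal (a x) * ennreal (V/2) \<partial>lebesgue)"
    using V_pos a_nn by (intro nn_integral_cong) (auto simp: ennreal_mult[symmetric] a_def mult_ac)
  also have "\<dots> \<le> (\<integral>\<^sup>+x. ennreal (a x) * emeasure lebesgue {y. (x, y) \<in> T} \<partial>lebesgue)"
    \<comment> \<open>Almost everywhere outside Omega, u = 0, and there the weight vanishes because
      g(0) = 0 by h >= 0; so slices over Omega suffice.\<close>
    using H_J0_AE[OF u]
  proof (intro nn_integral_mono_AE, eventually_elim)
    case (elim x)
    then show ?case
      using slice[of x] g0[of 0] h by (cases "x \<in> \<Omega>") (auto simp: a_def intro!: mult_left_mono)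
  qed
  also have "\<dots> = (\<integral>\<^sup>+x. \<integral>\<^sup>+y. ennreal (a (fst (x, y))) * indicator T (x, y) \<partial>lebesgue \<partial>lebesgue)"
  proof (intro nn_integral_cong)
    fix x :: 'n
    have "{y. (x, y) \<in> T} \<in> sets lebesgue"
      using sets_Pair1[OF T_meas, of x] by (simp add: vimage_def)
    moreover have "indicator T (x, y) = (indicator {y. (x, y) \<in> T} y :: ennreal)" for y
      by (simp add: indicator_def)
    ultimately show "ennreal (a x) * emeasure lebesgue {y. (x, y) \<in> T}
        = (\<integral>\<^sup>+y. ennreal (a (fst (x, y))) * indicator T (x, y) \<partial>lebesgue)"
      by (simp add: nn_integral_cmult_indicator)
  qed
  also have "\<dots> = (\<integral>\<^sup>+w. ennreal (a (fst w)) * indicator T w \<partial>(lebesgue \<Otimes>\<^sub>M lebesgue))"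
    using a_fst by (intro lebesgue.nn_integral_fst) measurable
  also have "\<dots> \<le> (\<integral>\<^sup>+w. ennreal (1/2 * dens u (\<lambda>x. g (u x)) w) \<partial>(lebesgue \<Otimes>\<^sub>M lebesgue))"
  proof (intro nn_integral_mono)
    fix w :: "'n \<times> 'n"
    show "ennreal (a (fst w)) * indicator T w \<le> ennreal (1/2 * dens u (\<lambda>x. g (u x)) w)"
    proof (cases "w \<in> T \<and> u (fst w) > h")
      case True
      then have w: "fst w \<in> \<Omega>" "u (snd w) \<le> h" "snd w - fst w \<in> ball z\<^sub>0 r" "u (fst w) > h"
        by (auto simp: T_def)
      \<comment> \<open>One endpoint in Omega is enough: y may lie outside, where the form still
        sees the jump.\<close>
      then have Q: "w \<in> Q_set \<Omega>" by (cases w) (auto simp: Q_set_def)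
      have "(u (fst w) - h) * g (u (fst w)) * c\<^sub>0
          \<le> (u (fst w) - u (snd w)) * (g (u (fst w)) - g (u (snd w))) * J (fst w) (snd w)"
        using w gnn c\<^sub>0_pos J_lower[of "snd w" "fst w"] g0[of "u (snd w)"]
        by (intro mult_mono) auto
      then show ?thesis
        using w Q by (auto simp: a_def dens_def mult_ac intro!: ennreal_leI split: split_indicator)
    next
      case False
      then show ?thesis by (auto simp: a_def indicator_def not_less)
    qed
  qed
  also have "\<dots> = ennreal (energy_form J \<Omega> u (\<lambda>x. g (u x)))"
    using energy_form_eq_nn_integral[OF u phi nn] by simp
  finally show ?thesis .
qed

end

section \<open>The Poincare inequality\<close>

text \<open>Telescope into n steps of length z. Cauchy-Schwarz costs one factor n, and the n steps
  have equal integrals by translation invariance, which gives the other.\<close>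

lemma nn_integral_diff_chain:
  fixes v :: "'n::euclidean_space \<Rightarrow> real"
  assumes [measurable]: "v \<in> borel_measurable borel"
  shows "(\<integral>\<^sup>+x. ennreal ((v (x + real n *\<^sub>R z) - v x)\<^sup>2) \<partial>lborel)
    \<le> ennreal ((real n)\<^sup>2) * (\<integral>\<^sup>+x. ennreal ((v (x + z) - v x)\<^sup>2) \<partial>lborel)"
proof -
  define d where "d i x = v (x + real (Suc i) *\<^sub>R z) - v (x + real i *\<^sub>R z)" for i x
  have [measurable]: "d i \<in> borel_measurable borel" for i
    unfolding d_def by measurable
  have d_shift: "(\<integral>\<^sup>+x. ennreal ((d i x)\<^sup>2) \<partial>lborel) = (\<integral>\<^sup>+x. ennreal ((v (x + z) - v x)\<^sup>2) \<partial>lborel)" for i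
    using nn_integral_lborel_translate[of "\<lambda>x. ennreal ((v (x + z) - v x)\<^sup>2)" "real i *\<^sub>R z"]
    by (simp add: d_def algebra_simps)
  have "(v (x + real n *\<^sub>R z) - v x)\<^sup>2 \<le> (\<Sum>i<n. (d i x)\<^sup>2) * real n" for x
  proof -
    have "v (x + real n *\<^sub>R z) - v x = (\<Sum>i<n. d i x)"
      unfolding d_def using sum_lessThan_telescope[of "\<lambda>i. v (x + real i *\<^sub>R z)" n] by simp
    then show ?thesis
      using sum_squared_le_sum_of_squares[of "\<lambda>i. d i x" "{..<n}"] by simp
  qed
  then have "(\<integral>\<^sup>+x. ennreal ((v (x + real n *\<^sub>R z) - v x)\<^sup>2) \<partial>lborel)
      \<le> (\<integral>\<^sup>+x. ennreal (real n) * (\<Sum>i<n. ennreal ((d i x)\<^sup>2)) \<partial>lborel)"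
    by (intro nn_integral_mono)
      (simp add: sum_ennreal ennreal_mult[symmetric] sum_nonneg mult.commute ennreal_leI)
  also have "\<dots> = ennreal (real n) * (\<Sum>i<n. (\<integral>\<^sup>+x. ennreal ((d i x)\<^sup>2) \<partial>lborel))"
    by (subst nn_integral_cmult, measurable) (subst nn_integral_sum, auto)
  finally show ?thesis
    unfolding d_shift
    by (simp add: power2_eq_square[of "real n"] ennreal_mult mult.assoc ennreal_of_nat_eq_real_of_nat)
qed

context kernel_bounded_below
begin

text \<open>Passing to a Borel representative and iterated \<open>lborel\<close> integrals makes
  translation and exchange of integrals available. Since \<open>v\<close> vanishes everywhere off
  Omega, the left integrand is zero on pairs outside \<open>Q_set \<Omega>\<close>.\<close>

lemma energy_nn_iterated_ge:
  assumes u: "u \<in> H_J0 J \<Omega>" and v[measurable]: "v \<in> borel_measurable borel"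
    and eq: "AE x in lborel. u x = v x" and v0: "\<And>x. x \<notin> \<Omega> \<Longrightarrow> v x = 0"
  shows "(\<integral>\<^sup>+x. \<integral>\<^sup>+y. ennreal (c\<^sub>0 / 2 * (indicator (ball z\<^sub>0 r) (y - x) * (v y - v x)\<^sup>2)) \<partial>lborel \<partial>lborel)
    \<le> energy_nn J \<Omega> u"
proof -
  have "(\<integral>\<^sup>+x. \<integral>\<^sup>+y. ennreal (c\<^sub>0 / 2 * (indicator (ball z\<^sub>0 r) (y - x) * (v y - v x)\<^sup>2)) \<partial>lborel \<partial>lborel)
    \<le> (\<integral>\<^sup>+x. \<integral>\<^sup>+y. ennreal (1/2 * dens u u (x, y)) \<partial>lborel \<partial>lborel)"
    using eq
  proof (intro nn_integral_mono_AE, eventually_elim)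
    case (elim x)
    show ?case
      using eq
    proof (intro nn_integral_mono_AE, eventually_elim)
      case e: (elim y)
      have "c\<^sub>0 * (indicator (ball z\<^sub>0 r) (y - x) * (v y - v x)\<^sup>2) \<le> dens u u (x, y)"
      proof (cases "y - x \<in> ball z\<^sub>0 r \<and> (x, y) \<in> Q_set \<Omega>")
        case True
        have "c\<^sub>0 * (v y - v x)\<^sup>2 \<le> J x y * (v y - v x)\<^sup>2"
          using True J_lower by (intro mult_right_mono) auto
        then show ?thesis
          using True e elim by (simp add: dens_def power2_eq_square algebra_simps)
      next
        case False
        then show ?thesis
          using dens_nonneg[of u "(x, y)"] v0 by (auto simp: Q_set_def)
      qed
      then show ?case by (intro ennreal_leI) simp
    qed
  qed
  also have "\<dots> = (\<integral>\<^sup>+x. \<integral>\<^sup>+y. ennreal (1/2 * dens u u (x, y)) \<partial>lebesgue \<partial>lebesgue)"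
    by (simp only: nn_integral_completion)
  also have "\<dots> = energy_nn J \<Omega> u"
    unfolding energy_nn_dens
    using dens_measurable[of u u] H_J0_measurable[OF u]
    by (intro lebesgue.nn_integral_fst[where f = "\<lambda>w. ennreal (1/2 * dens u u w)"]) auto
  finally show ?thesis .
qed

text \<open>For a single z the pairs (x, x + z) form a null set that the energy does not see. The
  inequality for each z is therefore averaged over the whole ball, and y = x + z turns the average
  into a part of the energy.\<close>

theorem Poincare_inequality:
  obtains P where "P > 0" "\<And>u. u \<in> H_J0 J \<Omega> \<Longrightarrow> (\<integral>\<^sup>+x. ennreal ((u x)\<^sup>2) \<partial>lebesgue) \<le> ennreal P * energy_nn J \<Omega> u"
proof -
  obtain D where D: "\<And>x y. x \<in> \<Omega> \<Longrightarrow> y \<in> \<Omega> \<Longrightarrow> dist x y \<le> D"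
    using \<Omega>_bdd by (auto simp: bounded_two_points)
  \<comment> \<open>One n serves all z in the ball, because each of them has length at least
    \<open>norm z\<^sub>0 - r\<close>.\<close>
  obtain n :: nat where n: "D < real n * (norm z\<^sub>0 - r)"
    using ex_less_of_nat_mult[of "norm z\<^sub>0 - r" D] r_less by (auto simp: mult.commute)
  \<comment> \<open>The quotient is what the averaging yields; the added 1 keeps P positive even if
    n = 0, which can happen for empty Omega.\<close>
  define P where "P = (real n)\<^sup>2 * 2 / (c\<^sub>0 * V) + 1"
  have "P > 0" unfolding P_def using c\<^sub>0_pos V_pos by (intro add_nonneg_pos) auto
  moreover have "(\<integral>\<^sup>+x. ennreal ((u x)\<^sup>2) \<partial>lebesgue) \<le> ennreal P * energy_nn J \<Omega> u" if u: "u \<in> H_J0 J \<Omega>" for u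
  proof -
    obtain v' where v': "v' \<in> borel_measurable lborel" "AE x in lborel. u x = v' x"
      using completion_ex_borel_measurable_real[OF H_J0_measurable[OF u]] by blast
    \<comment> \<open>The indicator turns the exterior condition from an almost-everywhere statement
      into a pointwise one.\<close>
    define v where "v x = indicator \<Omega> x * v' x" for x
    have [measurable]: "\<Omega> \<in> sets borel" using \<Omega>_open by simp
    have v[measurable]: "v \<in> borel_measurable borel"
      unfolding v_def using v'(1) by simp
    have v0: "\<And>x. x \<notin> \<Omega> \<Longrightarrow> v x = 0" by (simp add: v_def)
    have uv: "AE x in lborel. u x = v x"
      using v'(2) H_J0_AE[OF u] by (auto simp: v_def AE_completion_iff indicator_def)
    let ?N = "\<integral>\<^sup>+x. ennreal ((v x)\<^sup>2) \<partial>lborel"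
    let ?S = "\<lambda>z. \<integral>\<^sup>+x. ennreal ((v (x + z) - v x)\<^sup>2) \<partial>lborel"
    have step: "?N \<le> ennreal ((real n)\<^sup>2) * ?S z" if z: "z \<in> ball z\<^sub>0 r" for z
    proof -
      have "norm z\<^sub>0 - r \<le> norm z"
        using z norm_triangle_sub[of z\<^sub>0 z] by (simp add: dist_norm)
      then have far: "D < norm (real n *\<^sub>R z)"
        using n by (simp add: order_less_le_trans mult_left_mono)
      have "v (x + real n *\<^sub>R z) = 0" if "x \<in> \<Omega>" for x
        using D[OF that, of "x + real n *\<^sub>R z"] far by (intro v0) (auto simp: dist_norm)
      \<comment> \<open>For x in Omega the far endpoint contributes 0, and for x outside the left
        side is 0.\<close>
      then have "(v x)\<^sup>2 \<le> (v (x + real n *\<^sub>R z) - v x)\<^sup>2" for x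
        using v0 by (cases "x \<in> \<Omega>") auto
      then have "?N \<le> (\<integral>\<^sup>+x. ennreal ((v (x + real n *\<^sub>R z) - v x)\<^sup>2) \<partial>lborel)"
        by (intro nn_integral_mono ennreal_leI)
      also have "\<dots> \<le> ennreal ((real n)\<^sup>2) * ?S z"
        by (rule nn_integral_diff_chain[OF v])
      finally show ?thesis .
    qed
    let ?B = "indicator (ball z\<^sub>0 r) :: 'n \<Rightarrow> ennreal"
    have pull: "ennreal a * (ennreal b * (ennreal c * X)) = ennreal (a * (b * c)) * X"
      if "0 \<le> a" "0 \<le> b" "0 \<le> c" for a b c X
      using that by (simp add: ennreal_mult mult.assoc)
    have [measurable]: "ball z\<^sub>0 r \<in> sets borel" by simp
    have "ennreal V * ?N = (\<integral>\<^sup>+z. ?N * ?B z \<partial>lborel)"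
      using emeasure_ball_V[of z\<^sub>0] by (subst nn_integral_cmult_indicator) (auto simp: mult.commute)
    also have "\<dots> \<le> (\<integral>\<^sup>+z. ennreal ((real n)\<^sup>2) * (?S z * ?B z) \<partial>lborel)"
      using step by (intro nn_integral_mono) (auto simp: indicator_def)
    also have "\<dots> = ennreal ((real n)\<^sup>2) * (\<integral>\<^sup>+z. ?S z * ?B z \<partial>lborel)"
      by (intro nn_integral_cmult) measurable
    also have "(\<integral>\<^sup>+z. ?S z * ?B z \<partial>lborel) = (\<integral>\<^sup>+z. \<integral>\<^sup>+x. ennreal ((v (x + z) - v x)\<^sup>2) * ?B z \<partial>lborel \<partial>lborel)"
      by (intro nn_integral_cong nn_integral_multc[symmetric]) measurable
    also have "\<dots> = (\<integral>\<^sup>+x. \<integral>\<^sup>+z. ennreal ((v (x + z) - v x)\<^sup>2) * ?B z \<partial>lborel \<partial>lborel)"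
      by (rule lborel_pair.Fubini') measurable
    also have "\<dots> = (\<integral>\<^sup>+x. \<integral>\<^sup>+y. ennreal ((v y - v x)\<^sup>2) * ?B (y - x) \<partial>lborel \<partial>lborel)"
    proof (rule nn_integral_cong)
      fix x :: 'n
      show "(\<integral>\<^sup>+z. ennreal ((v (x + z) - v x)\<^sup>2) * ?B z \<partial>lborel) = (\<integral>\<^sup>+y. ennreal ((v y - v x)\<^sup>2) * ?B (y - x) \<partial>lborel)"
        using nn_integral_lborel_translate[of "\<lambda>y. ennreal ((v y - v x)\<^sup>2) * ?B (y - x)" x] by simp
    qed
    also have "\<dots> = (\<integral>\<^sup>+x. \<integral>\<^sup>+y. ennreal (2 / c\<^sub>0) *
        ennreal (c\<^sub>0 / 2 * (indicator (ball z\<^sub>0 r) (y - x) * (v y - v x)\<^sup>2)) \<partial>lborel \<partial>lborel)"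
      using c\<^sub>0_pos by (intro nn_integral_cong) (auto simp: indicator_def ennreal_mult[symmetric])
    also have "\<dots> = ennreal (2 / c\<^sub>0) * (\<integral>\<^sup>+x. \<integral>\<^sup>+y.
        ennreal (c\<^sub>0 / 2 * (indicator (ball z\<^sub>0 r) (y - x) * (v y - v x)\<^sup>2)) \<partial>lborel \<partial>lborel)"
      by (simp add: nn_integral_cmult)
    finally have "ennreal V * ?N \<le> ennreal ((real n)\<^sup>2) * (ennreal (2 / c\<^sub>0) * energy_nn J \<Omega> u)"
      using energy_nn_iterated_ge[OF u v uv v0] by (meson order_trans mult_left_mono zero_le)
    then have "ennreal (1 / V) * (ennreal V * ?N) \<le>
        ennreal (1 / V) * (ennreal ((real n)\<^sup>2) * (ennreal (2 / c\<^sub>0) * energy_nn J \<Omega> u))"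
      by (intro mult_left_mono) auto
    also have "ennreal (1 / V) * (ennreal V * ?N) = ?N"
      using V_pos by (simp add: mult.assoc[symmetric] ennreal_mult[symmetric])
    also have "ennreal (1 / V) * (ennreal ((real n)\<^sup>2) * (ennreal (2 / c\<^sub>0) * energy_nn J \<Omega> u))
        = ennreal (1 / V * ((real n)\<^sup>2 * (2 / c\<^sub>0))) * energy_nn J \<Omega> u"
      using V_pos c\<^sub>0_pos by (intro pull) auto
    also have "1 / V * ((real n)\<^sup>2 * (2 / c\<^sub>0)) = (real n)\<^sup>2 * 2 / (c\<^sub>0 * V)"
      by (simp add: mult.commute)
    also have "ennreal ((real n)\<^sup>2 * 2 / (c\<^sub>0 * V)) * energy_nn J \<Omega> u \<le> ennreal P * energy_nn J \<Omega> u"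
      unfolding P_def by (intro mult_right_mono ennreal_leI) auto
    also have "?N = (\<integral>\<^sup>+x. ennreal ((u x)\<^sup>2) \<partial>lebesgue)"
      unfolding nn_integral_completion using uv by (intro nn_integral_cong_AE) auto
    finally show ?thesis .
  qed
  ultimately show thesis using that by blast
qed

end

section \<open>Powers, absorption and the norm\<close>

text \<open>Mean value theorem with the increasing derivative q x^(q-1). For q > 1 there is no
  global Lipschitz constant, which is why the test functions are capped at m.\<close>

lemma powr_Lipschitz_on_interval:
  fixes q :: real
  assumes q: "q \<ge> 1" and s: "0 \<le> s" "s \<le> m" and t: "0 \<le> t" "t \<le> m"
  shows "\<bar>s powr q - t powr q\<bar> \<le> q * m powr (q - 1) * \<bar>s - t\<bar>"
proof -
  have *: "\<bar>b powr q - a powr q\<bar> \<le> q * m powr (q - 1) * \<bar>b - a\<bar>" if "0 \<le> a" "a < b" "b \<le> m" for a b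
  proof -
    \<comment> \<open>The endpoint a may be 0, so only continuity is used there and
      differentiability only to its right.\<close>
    have "continuous_on {a..b} (\<lambda>x. x powr q)"
      using q that by (intro continuous_on_powr') (auto intro!: continuous_intros)
    moreover have d: "((\<lambda>x. x powr q) has_real_derivative q * x powr (q - 1)) (at x)" if "a < x" for x
      using \<open>0 \<le> a\<close> that by (auto intro!: derivative_eq_intros simp: powr_diff)
    ultimately obtain l x where x: "a < x" "x < b" "DERIV (\<lambda>x. x powr q) x :> l"
        "b powr q - a powr q = (b - a) * l"
      using MVT[OF \<open>a < b\<close>, of "\<lambda>x. x powr q"] by (metis real_differentiable_def)
    then have l: "l = q * x powr (q - 1)"
      using DERIV_unique d by blast
    have "x powr (q - 1) \<le> m powr (q - 1)"
      using x that q by (intro powr_mono2) auto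
    then have "(b - a) * l \<le> (b - a) * (q * m powr (q - 1))" "0 \<le> (b - a) * l"
      unfolding l using that q by (auto intro!: mult_left_mono)
    then show ?thesis
      using x(4) that by (simp add: mult.commute)
  qed
  show ?thesis
    using *[of s t] *[of t s] s t by (cases s t rule: linorder_cases) (auto simp: abs_minus_commute)
qed

lemma ennreal_linear_combination:
  assumes "0 \<le> a" "0 \<le> x" "0 \<le> b" "0 \<le> y"
  shows "ennreal (a * x + b * y) = ennreal a * ennreal x + ennreal b * ennreal y"
  using assms by (simp add: ennreal_mult)

text \<open>Finiteness of X is essential: X = \<infinity> satisfies the first premise for every
  Z.\<close>

lemma ennreal_absorb_half:
  fixes X Z :: ennreal
  assumes "X \<le> ennreal (1/2) * X + ennreal (1/2) * Z" "X < \<infinity>"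
  shows "X \<le> Z"
proof (cases Z)
  case (real z)
  obtain x where x: "X = ennreal x" "x \<ge> 0"
    using assms(2) by (cases X) auto
  have "ennreal x \<le> ennreal (1/2 * x + 1/2 * z)"
    using assms(1) real x by (subst ennreal_linear_combination) auto
  then have "x \<le> 1/2 * x + 1/2 * z"
    using x real by (subst (asm) ennreal_le_iff) auto
  then show ?thesis
    using x real by (simp add: ennreal_leI)
qed simp

lemma Lp_norm_le_iff:
  assumes p: "p \<noteq> \<infinity>" "1 \<le> p" and F: "F > 0"
  shows "Lp_norm \<Omega> p f \<le> ennreal F \<longleftrightarrow>
    (\<integral>\<^sup>+x\<in>\<Omega>. ennreal (\<bar>f x\<bar> powr enn2real p) \<partial>lebesgue) \<le> ennreal (F powr enn2real p)"
proof -
  have q: "enn2real p \<ge> 1"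
    using p by (cases p) auto
  show ?thesis
  proof (cases "\<integral>\<^sup>+x\<in>\<Omega>. ennreal (\<bar>f x\<bar> powr enn2real p) \<partial>lebesgue")
    case (real i)
    have "i powr (1 / enn2real p) \<le> F \<longleftrightarrow> i \<le> F powr enn2real p"
    proof
      assume "i powr (1 / enn2real p) \<le> F"
      then have "(i powr (1 / enn2real p)) powr enn2real p \<le> F powr enn2real p"
        using q by (intro powr_mono2) auto
      then show "i \<le> F powr enn2real p"
        using q real by (simp add: powr_powr)
    next
      assume "i \<le> F powr enn2real p"
      then have "i powr (1 / enn2real p) \<le> (F powr enn2real p) powr (1 / enn2real p)"
        using q real by (intro powr_mono2) auto
      then show "i powr (1 / enn2real p) \<le> F"
        using q F by (simp add: powr_powr)
    qed
    then show ?thesis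
      using p real F by (simp add: Lp_norm_def Let_def ennreal_le_iff)
  next
    case top
    then show ?thesis using p by (simp add: Lp_norm_def Let_def top_unique)
  qed
qed

section \<open>The L^2 bound and the choice of the level\<close>

context kernel_bounded_below
begin

lemma H_J0_square_finite:
  assumes "u \<in> H_J0 J \<Omega>"
  shows "(\<integral>\<^sup>+x. ennreal ((u x)\<^sup>2) \<partial>lebesgue) < \<infinity>"
proof -
  have "(\<integral>\<^sup>+x. ennreal ((u x)\<^sup>2) \<partial>lebesgue) = (\<integral>\<^sup>+x\<in>\<Omega>. ennreal ((u x)\<^sup>2) \<partial>lebesgue)"
    using H_J0_AE[OF assms] by (intro nn_integral_cong_AE) (auto simp: indicator_def)
  then show ?thesis using assms by (simp add: H_J0_def)
qed

lemma weak_solution_uminus: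
  assumes "weak_solution J \<Omega> f u"
  shows "weak_solution J \<Omega> (\<lambda>x. - f x) (\<lambda>x. - u x)"
proof -
  have "(\<lambda>x. - u x) \<in> H_J0 J \<Omega>"
    using H_J0_comp_Lipschitz[of u uminus 1] assms by (auto simp: weak_solution_def)
  moreover have "energy_form J \<Omega> (\<lambda>x. - u x) \<phi> = - energy_form J \<Omega> u \<phi>" for \<phi>
  proof -
    have "dens (\<lambda>x. - u x) \<phi> w = - dens u \<phi> w" for w
      by (simp add: dens_def algebra_simps)
    then show ?thesis by (simp add: energy_form_dens)
  qed
  moreover have "(LINT x:\<Omega>|lebesgue. - f x * \<phi> x) = - (LINT x:\<Omega>|lebesgue. f x * \<phi> x)" for \<phi>
    by (simp add: set_lebesgue_integral_def)
  ultimately show ?thesis using assms by (simp add: weak_solution_def)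
qed

text \<open>The source is only known to be measurable after multiplication by the indicator of
  Omega, so g is applied to that product and the two agree on Omega.\<close>

lemma source_measurable:
  fixes f g :: "_ \<Rightarrow> real"
  assumes f: "set_borel_measurable lebesgue \<Omega> f" and g: "g \<in> borel_measurable borel"
  shows "(\<lambda>x. ennreal (g (f x)) * indicator \<Omega> x) \<in> borel_measurable lebesgue"
proof -
  have "(\<lambda>x. ennreal (g (indicator \<Omega> x *\<^sub>R f x)) * indicator \<Omega> x) \<in> borel_measurable lebesgue"
    using f g \<Omega>_sets unfolding set_borel_measurable_def by measurable
  also have "(\<lambda>x. ennreal (g (indicator \<Omega> x *\<^sub>R f x)) * indicator \<Omega> x) = (\<lambda>x. ennreal (g (f x)) * indicator \<Omega> x)"
    by (auto simp: indicator_def fun_eq_iff)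
  finally show ?thesis .
qed

text \<open>Test with u itself, apply the Poincare inequality, split P |f| |u| by Young's inequality
  and absorb half of the integral of u^2, which is finite by membership in
  \<open>H_J0\<close>.\<close>

lemma weak_solution_L2_bound:
  assumes sol: "weak_solution J \<Omega> f u" and f: "set_borel_measurable lebesgue \<Omega> f"
    and P: "P > 0" "\<And>u. u \<in> H_J0 J \<Omega> \<Longrightarrow> (\<integral>\<^sup>+x. ennreal ((u x)\<^sup>2) \<partial>lebesgue) \<le> ennreal P * energy_nn J \<Omega> u"
  shows "(\<integral>\<^sup>+x. ennreal ((u x)\<^sup>2) \<partial>lebesgue) \<le> ennreal (P\<^sup>2) * (\<integral>\<^sup>+x\<in>\<Omega>. ennreal ((f x)\<^sup>2) \<partial>lebesgue)"
proof (rule ennreal_absorb_half)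
  have u: "u \<in> H_J0 J \<Omega>" using sol by (simp add: weak_solution_def)
  note [measurable] = H_J0_measurable[OF u] source_measurable[OF f]
  have "(\<integral>\<^sup>+x. ennreal ((u x)\<^sup>2) \<partial>lebesgue) \<le> ennreal P * (\<integral>\<^sup>+x\<in>\<Omega>. ennreal (\<bar>f x\<bar> * \<bar>u x\<bar>) \<partial>lebesgue)"
    using energy_le_source[OF sol u] unfolding energy_form_self[OF u]
    by (intro order_trans[OF P(2)[OF u]] mult_left_mono) auto
  also have "\<dots> = (\<integral>\<^sup>+x. ennreal P * (ennreal (\<bar>f x\<bar> * \<bar>u x\<bar>) * indicator \<Omega> x) \<partial>lebesgue)"
  proof (rule nn_integral_cmult[symmetric])
    have "(\<lambda>x. ennreal (\<bar>f x\<bar>) * indicator \<Omega> x * ennreal \<bar>u x\<bar>) \<in> borel_measurable lebesgue"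
      by measurable
    then show "(\<lambda>x. ennreal (\<bar>f x\<bar> * \<bar>u x\<bar>) * indicator \<Omega> x) \<in> borel_measurable lebesgue"
      by (simp add: ennreal_mult mult_ac)
  qed
  also have "\<dots> \<le> (\<integral>\<^sup>+x. ennreal (1/2) * ennreal ((u x)\<^sup>2)
      + ennreal (1/2) * (ennreal (P\<^sup>2) * (ennreal ((f x)\<^sup>2) * indicator \<Omega> x)) \<partial>lebesgue)"
  proof (intro nn_integral_mono)
    fix x
    have "P * (\<bar>f x\<bar> * \<bar>u x\<bar>) \<le> 1/2 * (u x)\<^sup>2 + 1/2 * (P\<^sup>2 * (f x)\<^sup>2)"
      using sum_squares_bound[of "P * \<bar>f x\<bar>" "\<bar>u x\<bar>"] P by (simp add: power_mult_distrib)
    then have "ennreal (P * (\<bar>f x\<bar> * \<bar>u x\<bar>)) \<le> ennreal (1/2 * (u x)\<^sup>2 + 1/2 * (P\<^sup>2 * (f x)\<^sup>2))"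
      by (rule ennreal_leI)
    also have "\<dots> = ennreal (1/2) * ennreal ((u x)\<^sup>2) + ennreal (1/2) * (ennreal (P\<^sup>2) * ennreal ((f x)\<^sup>2))"
      by (subst ennreal_linear_combination) (auto simp: ennreal_mult simp del: ennreal_half)
    finally show "ennreal P * (ennreal (\<bar>f x\<bar> * \<bar>u x\<bar>) * indicator \<Omega> x)
        \<le> ennreal (1/2) * ennreal ((u x)\<^sup>2) + ennreal (1/2) * (ennreal (P\<^sup>2) * (ennreal ((f x)\<^sup>2) * indicator \<Omega> x))"
      using P by (auto simp: indicator_def ennreal_mult)
  qed
  also have "\<dots> = ennreal (1/2) * (\<integral>\<^sup>+x. ennreal ((u x)\<^sup>2) \<partial>lebesgue)
      + ennreal (1/2) * (ennreal (P\<^sup>2) * (\<integral>\<^sup>+x\<in>\<Omega>. ennreal ((f x)\<^sup>2) \<partial>lebesgue))"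
    using source_measurable[OF f, of "\<lambda>t. t\<^sup>2"]
    by (subst nn_integral_add) (auto simp: nn_integral_cmult)
  finally show "(\<integral>\<^sup>+x. ennreal ((u x)\<^sup>2) \<partial>lebesgue) \<le> \<dots>" .
  show "(\<integral>\<^sup>+x. ennreal ((u x)\<^sup>2) \<partial>lebesgue) < \<infinity>"
    by (rule H_J0_square_finite[OF u])
qed

text \<open>Chebyshev's inequality, with B calibrated so that B / h^2 <= V/2.\<close>

lemma superlevel_small:
  assumes u: "u \<in> borel_measurable lebesgue"
    and B: "(\<integral>\<^sup>+x. ennreal ((u x)\<^sup>2) \<partial>lebesgue) \<le> ennreal B" "B \<le> h\<^sup>2 * V / 2" and h: "h > 0"
  shows "emeasure lebesgue {x. h < u x} \<le> ennreal (V/2)"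
proof -
  have A: "{x. h < u x} \<in> sets lebesgue"
    using u by (simp add: borel_measurable_iff_greater)
  have "ennreal (h\<^sup>2) * emeasure lebesgue {x. h < u x} = (\<integral>\<^sup>+x. ennreal (h\<^sup>2) * indicator {x. h < u x} x \<partial>lebesgue)"
    using A by (simp add: nn_integral_cmult_indicator)
  also have "\<dots> \<le> (\<integral>\<^sup>+x. ennreal ((u x)\<^sup>2) \<partial>lebesgue)"
    using h by (intro nn_integral_mono) (auto simp: indicator_def intro!: ennreal_leI power_mono)
  also have "\<dots> \<le> ennreal (h\<^sup>2 * V / 2)"
    using B by (meson ennreal_leI order_trans)
  finally have "ennreal (1 / h\<^sup>2) * (ennreal (h\<^sup>2) * emeasure lebesgue {x. h < u x}) \<le> ennreal (1 / h\<^sup>2) * ennreal (h\<^sup>2 * V / 2)"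
    by (intro mult_left_mono) auto
  then show ?thesis
    using h V_pos by (simp add: mult.assoc[symmetric] ennreal_mult[symmetric])
qed

definition \<kappa> :: real where "\<kappa> = c\<^sub>0 * V / 4"

lemma \<kappa>_pos: "\<kappa> > 0"
  unfolding \<kappa>_def using c\<^sub>0_pos V_pos by simp

section \<open>Estimates above the level for finite and infinite exponents\<close>

lemma level_estimate_source:
  assumes sol: "weak_solution J \<Omega> f u" and g: "\<And>s t. \<bar>g s - g t\<bar> \<le> L * \<bar>s - t\<bar>" and mono: "mono g"
    and g0: "\<And>t. t \<le> h \<Longrightarrow> g t = 0" and h: "h \<ge> 0"
    and small: "emeasure lebesgue {x. h < u x} \<le> ennreal (V/2)"
  shows "(\<integral>\<^sup>+x. ennreal (\<kappa> * (max 0 (u x - h) * g (u x))) \<partial>lebesgue)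
    \<le> (\<integral>\<^sup>+x\<in>\<Omega>. ennreal (\<bar>f x\<bar> * g (u x)) \<partial>lebesgue)"
proof -
  have u: "u \<in> H_J0 J \<Omega>" using sol by (simp add: weak_solution_def)
  have gnn: "g t \<ge> 0" for t
    using monoD[OF mono, of "min t h" t] g0[of "min t h"] by simp
  have phi: "(\<lambda>x. g (u x)) \<in> H_J0 J \<Omega>"
    using H_J0_comp_Lipschitz[OF u g] g0 h by auto
  from level_estimate[OF u g mono g0 h small] energy_le_source[OF sol phi]
  show ?thesis
    using gnn by (simp add: \<kappa>_def)
qed

text \<open>With T the part of u above h capped at m, testing with T^(p-1) bounds \<kappa> times the
  integral of T^p by that of |f| T^(p-1). Half of the left side is absorbed. The result is
  independent of m, and its constant is exactly a p-th power.\<close>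

lemma truncated_power_bound:
  assumes sol: "weak_solution J \<Omega> f u" and f: "set_borel_measurable lebesgue \<Omega> f"
    and p: "p \<ge> 2" and h: "h \<ge> 0" and small: "emeasure lebesgue {x. h < u x} \<le> ennreal (V/2)" and m: "m > 0"
  shows "(\<integral>\<^sup>+x. ennreal (min (max 0 (u x - h)) m powr p) \<partial>lebesgue)
    \<le> ennreal ((2 / \<kappa>) powr p) * (\<integral>\<^sup>+x\<in>\<Omega>. ennreal (\<bar>f x\<bar> powr p) \<partial>lebesgue)"
proof (rule ennreal_absorb_half)
  have u: "u \<in> H_J0 J \<Omega>" using sol by (simp add: weak_solution_def)
  note [measurable] = H_J0_measurable[OF u]
  define T where "T t = min (max 0 (t - h)) m" for t
  have T: "0 \<le> T t" "T t \<le> m" "T t \<le> max 0 (t - h)" "\<bar>T s - T t\<bar> \<le> \<bar>s - t\<bar>" for s t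
    using m by (auto simp: T_def min_def max_def)
  have T_meas[measurable]: "T \<in> borel_measurable borel"
    unfolding T_def by measurable
  define g where "g t = T t powr (p - 1)" for t
  have Lip: "\<bar>g s - g t\<bar> \<le> ((p - 1) * m powr (p - 1 - 1)) * \<bar>s - t\<bar>" for s t
  proof -
    have "\<bar>g s - g t\<bar> \<le> (p - 1) * m powr (p - 1 - 1) * \<bar>T s - T t\<bar>"
      unfolding g_def using T p by (intro powr_Lipschitz_on_interval) auto
    also have "\<dots> \<le> (p - 1) * m powr (p - 1 - 1) * \<bar>s - t\<bar>"
      using T p by (intro mult_left_mono) auto
    finally show ?thesis .
  qed
  have mono: "mono g"
    unfolding g_def using T p m by (intro monoI powr_mono2) (auto simp: T_def)
  have g0: "g t = 0" if "t \<le> h" for t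
    using that p m by (simp add: g_def T_def)
  have split_powr: "a powr p = a * a powr (p - 1)" if "a \<ge> 0" for a :: real
    using that p by (cases "a = 0") (auto simp: powr_diff)
  let ?X = "\<integral>\<^sup>+x. ennreal (T (u x) powr p) \<partial>lebesgue"
  let ?Y = "\<integral>\<^sup>+x\<in>\<Omega>. ennreal (\<bar>f x\<bar> powr p) \<partial>lebesgue"
  have f_meas[measurable]: "(\<lambda>x. ennreal (\<bar>f x\<bar> powr p) * indicator \<Omega> x) \<in> borel_measurable lebesgue"
    using source_measurable[OF f, of "\<lambda>t. \<bar>t\<bar> powr p"] by simp
  have "ennreal \<kappa> * ?X = (\<integral>\<^sup>+x. ennreal (\<kappa> * T (u x) powr p) \<partial>lebesgue)"
    using \<kappa>_pos by (subst nn_integral_cmult[symmetric]) (auto simp: ennreal_mult)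
  also have "\<dots> \<le> (\<integral>\<^sup>+x. ennreal (\<kappa> * (max 0 (u x - h) * g (u x))) \<partial>lebesgue)"
    unfolding g_def split_powr[OF T(1)] using T \<kappa>_pos
    by (intro nn_integral_mono ennreal_leI mult_left_mono mult_right_mono) auto
  also have "\<dots> \<le> (\<integral>\<^sup>+x\<in>\<Omega>. ennreal (\<bar>f x\<bar> * g (u x)) \<partial>lebesgue)"
    by (rule level_estimate_source[OF sol Lip mono g0 h small])
  also have "\<dots> \<le> (\<integral>\<^sup>+x. ennreal (\<kappa> / 2) * ennreal (T (u x) powr p)
      + ennreal (\<kappa> / 2) * (ennreal ((2 / \<kappa>) powr p) * (ennreal (\<bar>f x\<bar> powr p) * indicator \<Omega> x)) \<partial>lebesgue)"
  proof (intro nn_integral_mono)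
    fix x
    define a where "a = \<bar>f x\<bar>"
    define w where "w = T (u x)"
    have nn: "a \<ge> 0" "w \<ge> 0" using T by (auto simp: a_def w_def)
    have "a * w powr (p - 1) \<le> \<kappa> / 2 * w powr p + \<kappa> / 2 * ((2 / \<kappa>) powr p * a powr p)"
    \<comment> \<open>This dichotomy replaces Young's inequality with conjugate exponents: either a
      is small enough to be absorbed, or w <= (2/\<kappa>) a and only the source term
      remains.\<close>
    proof (cases "a \<le> \<kappa> / 2 * w")
      case True
      then have "a * w powr (p - 1) \<le> \<kappa> / 2 * w * w powr (p - 1)"
        by (intro mult_right_mono) auto
      also have "\<dots> = \<kappa> / 2 * w powr p" using nn by (simp add: split_powr)
      also have "\<dots> \<le> \<dots> + \<kappa> / 2 * ((2 / \<kappa>) powr p * a powr p)" using \<kappa>_pos by simp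
      finally show ?thesis .
    next
      case False
      then have "w \<le> 2 / \<kappa> * a" using \<kappa>_pos by (simp add: field_simps)
      then have "a * w powr (p - 1) \<le> a * (2 / \<kappa> * a) powr (p - 1)"
        using nn p by (intro mult_left_mono powr_mono2) auto
      also have "\<dots> = \<kappa> / 2 * (2 / \<kappa> * a * (2 / \<kappa> * a) powr (p - 1))" using \<kappa>_pos by simp
      also have "2 / \<kappa> * a * (2 / \<kappa> * a) powr (p - 1) = (2 / \<kappa>) powr p * a powr p"
        using nn \<kappa>_pos by (subst split_powr[symmetric]) (auto simp: powr_mult[symmetric])
      finally show ?thesis using \<kappa>_pos by (simp add: add_increasing)
    qed
    then have "ennreal (a * w powr (p - 1)) \<le> ennreal (\<kappa> / 2 * w powr p + \<kappa> / 2 * ((2 / \<kappa>) powr p * a powr p))"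
      by (rule ennreal_leI)
    also have "\<dots> = ennreal (\<kappa> / 2) * ennreal (w powr p) + ennreal (\<kappa> / 2) * (ennreal ((2 / \<kappa>) powr p) * ennreal (a powr p))"
      using \<kappa>_pos by (subst ennreal_linear_combination) (auto simp: ennreal_mult)
    finally show "ennreal (\<bar>f x\<bar> * g (u x)) * indicator \<Omega> x \<le> ennreal (\<kappa> / 2) * ennreal (T (u x) powr p)
      + ennreal (\<kappa> / 2) * (ennreal ((2 / \<kappa>) powr p) * (ennreal (\<bar>f x\<bar> powr p) * indicator \<Omega> x))"
      by (auto simp: indicator_def a_def w_def g_def)
  qed
  also have "\<dots> = ennreal (\<kappa> / 2) * ?X + ennreal (\<kappa> / 2) * (ennreal ((2 / \<kappa>) powr p) * ?Y)"
    by (subst nn_integral_add) (auto simp: nn_integral_cmult)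
  finally have "ennreal (1 / \<kappa>) * (ennreal \<kappa> * ?X)
      \<le> ennreal (1 / \<kappa>) * (ennreal (\<kappa> / 2) * ?X + ennreal (\<kappa> / 2) * (ennreal ((2 / \<kappa>) powr p) * ?Y))"
    by (intro mult_left_mono) auto
  moreover have "ennreal (1 / \<kappa>) * ennreal \<kappa> = 1" "ennreal (1 / \<kappa>) * ennreal (\<kappa> / 2) = ennreal (1/2)"
    using \<kappa>_pos by (simp_all add: ennreal_mult[symmetric])
  ultimately have "?X \<le> ennreal (1/2) * ?X + ennreal (1/2) * (ennreal ((2 / \<kappa>) powr p) * ?Y)"
    by (simp only: distrib_left mult.assoc[symmetric] mult_1_left)
  then show "(\<integral>\<^sup>+x. ennreal (min (max 0 (u x - h)) m powr p) \<partial>lebesgue)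
      \<le> ennreal (1/2) * (\<integral>\<^sup>+x. ennreal (min (max 0 (u x - h)) m powr p) \<partial>lebesgue)
        + ennreal (1/2) * (ennreal ((2 / \<kappa>) powr p) * ?Y)"
    by (simp add: T_def)
  have A: "{x. h < u x} \<in> sets lebesgue"
    using H_J0_measurable[OF u] by (simp add: borel_measurable_iff_greater)
  \<comment> \<open>Finiteness needed for the absorption: T is at most m and lives on a set of
    measure at most V/2.\<close>
  have "?X \<le> (\<integral>\<^sup>+x. ennreal (m powr p) * indicator {x. h < u x} x \<partial>lebesgue)"
  proof (intro nn_integral_mono)
    fix x
    show "ennreal (T (u x) powr p) \<le> ennreal (m powr p) * indicator {x. h < u x} x"
      using T(1,2)[of "u x"] p m by (cases "h < u x") (auto simp: T_def intro!: ennreal_leI powr_mono2)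
  qed
  also have "\<dots> = ennreal (m powr p) * emeasure lebesgue {x. h < u x}"
    using A by (simp add: nn_integral_cmult_indicator)
  also have "\<dots> \<le> ennreal (m powr p) * ennreal (V / 2)"
    by (intro mult_left_mono small) simp
  also have "\<dots> < \<infinity>" by (simp add: ennreal_mult_less_top del: ennreal_half)
  finally show "(\<integral>\<^sup>+x. ennreal (min (max 0 (u x - h)) m powr p) \<partial>lebesgue) < \<infinity>"
    by (simp add: T_def)
qed

text \<open>Monotone convergence in the cap, which is legitimate because the truncated bound does
  not involve m. The caps \<open>Suc n\<close> are positive, as that bound demands.\<close>

lemma power_bound_above_level:
  assumes sol: "weak_solution J \<Omega> f u" and f: "set_borel_measurable lebesgue \<Omega> f"
    and p: "p \<ge> 2" and h: "h \<ge> 0" and small: "emeasure lebesgue {x. h < u x} \<le> ennreal (V/2)"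
  shows "(\<integral>\<^sup>+x. ennreal (max 0 (u x - h) powr p) \<partial>lebesgue)
    \<le> ennreal ((2 / \<kappa>) powr p) * (\<integral>\<^sup>+x\<in>\<Omega>. ennreal (\<bar>f x\<bar> powr p) \<partial>lebesgue)"
proof -
  have [measurable]: "u \<in> borel_measurable lebesgue"
    using sol H_J0_measurable by (simp add: weak_solution_def)
  let ?w = "\<lambda>n x. ennreal (min (max 0 (u x - h)) (real (Suc n)) powr p)"
  have "(\<lambda>n. integral\<^sup>N lebesgue (?w n)) \<longlonglongrightarrow> (\<integral>\<^sup>+x. ennreal (max 0 (u x - h) powr p) \<partial>lebesgue)"
  proof (rule nn_integral_LIMSEQ)
    show "incseq ?w"
      using p by (auto simp: incseq_def le_fun_def intro!: ennreal_leI powr_mono2)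
    show "(\<lambda>n. ?w n x) \<longlonglongrightarrow> ennreal (max 0 (u x - h) powr p)" for x
    proof (rule tendsto_eventually)
      obtain N where N: "max 0 (u x - h) \<le> real N"
        using real_arch_simple by blast
      then have "?w n x = ennreal (max 0 (u x - h) powr p)" if "n \<ge> N" for n
        using that by (simp add: min_absorb1)
      then show "\<forall>\<^sub>F n in sequentially. ?w n x = ennreal (max 0 (u x - h) powr p)"
        by (auto simp: eventually_sequentially)
    qed
  qed measurable
  then show ?thesis
    by (rule LIMSEQ_le_const2) (use truncated_power_bound[OF sol f p h small] in auto)
qed

text \<open>Where g is positive, \<kappa> (u - h) = \<kappa> g + F. The level estimate thus reads
  \<kappa> int g^2 + F int g <= F int g, and cancelling the finite term F int g forces g(u) = 0
  almost everywhere.\<close>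

lemma upper_bound_above_level:
  assumes sol: "weak_solution J \<Omega> f u"
    and F: "F \<ge> 0" "AE x in lebesgue. x \<in> \<Omega> \<longrightarrow> \<bar>f x\<bar> \<le> F"
    and h: "h \<ge> 0" and small: "emeasure lebesgue {x. h < u x} \<le> ennreal (V/2)"
  shows "AE x in lebesgue. u x \<le> h + F / \<kappa>"
proof -
  have u: "u \<in> H_J0 J \<Omega>" using sol by (simp add: weak_solution_def)
  note [measurable] = H_J0_measurable[OF u]
  define g where "g t = max 0 (t - h - F / \<kappa>)" for t
  have Fk: "F / \<kappa> \<ge> 0" using F \<kappa>_pos by simp
  have "(\<integral>\<^sup>+x. ennreal (\<kappa> * (max 0 (u x - h) * g (u x))) \<partial>lebesgue)
      \<le> (\<integral>\<^sup>+x\<in>\<Omega>. ennreal (\<bar>f x\<bar> * g (u x)) \<partial>lebesgue)"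
    using Fk by (intro level_estimate_source[OF sol, of g 1] h small) (auto simp: g_def mono_def max_def)
  also have "\<dots> \<le> (\<integral>\<^sup>+x. ennreal (F * g (u x)) \<partial>lebesgue)"
    using F(2)
    by (intro nn_integral_mono_AE, eventually_elim)
      (auto simp: indicator_def g_def intro!: ennreal_leI mult_right_mono)
  finally have le: "(\<integral>\<^sup>+x. ennreal (\<kappa> * (max 0 (u x - h) * g (u x))) \<partial>lebesgue) \<le> (\<integral>\<^sup>+x. ennreal (F * g (u x)) \<partial>lebesgue)" .
  have "\<kappa> * (max 0 (t - h) * g t) = \<kappa> * (g t)\<^sup>2 + F * g t" for t
  proof (cases "t - h - F / \<kappa> \<le> 0")
    case False
    then have g_t: "g t = t - h - F / \<kappa>" and t: "max 0 (t - h) = g t + F / \<kappa>"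
      using Fk by (auto simp: g_def)
    show ?thesis
      unfolding t using \<kappa>_pos by (simp add: power2_eq_square distrib_left distrib_right)
  qed (simp add: g_def)
  then have "(\<integral>\<^sup>+x. ennreal (\<kappa> * (max 0 (u x - h) * g (u x))) \<partial>lebesgue)
      = (\<integral>\<^sup>+x. ennreal (\<kappa> * (g (u x))\<^sup>2) + ennreal (F * g (u x)) \<partial>lebesgue)"
    using F \<kappa>_pos by (simp add: g_def)
  also have "\<dots> = (\<integral>\<^sup>+x. ennreal (\<kappa> * (g (u x))\<^sup>2) \<partial>lebesgue) + (\<integral>\<^sup>+x. ennreal (F * g (u x)) \<partial>lebesgue)"
    unfolding g_def by (intro nn_integral_add) measurable
  finally have le2: "(\<integral>\<^sup>+x. ennreal (\<kappa> * (g (u x))\<^sup>2) \<partial>lebesgue) + (\<integral>\<^sup>+x. ennreal (F * g (u x)) \<partial>lebesgue)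
      \<le> 0 + (\<integral>\<^sup>+x. ennreal (F * g (u x)) \<partial>lebesgue)"
    using le by simp
  have A: "{x. h < u x} \<in> sets lebesgue"
    using H_J0_measurable[OF u] by (simp add: borel_measurable_iff_greater)
  \<comment> \<open>Cancellation requires this integral to be finite: g(u) is supported in {u > h},
    of finite measure, and g(u) <= |u| <= 1 + u^2 there.\<close>
  have "(\<integral>\<^sup>+x. ennreal (F * g (u x)) \<partial>lebesgue)
      \<le> (\<integral>\<^sup>+x. ennreal F * (indicator {x. h < u x} x + ennreal ((u x)\<^sup>2)) \<partial>lebesgue)"
  proof (intro nn_integral_mono)
    fix x
    have "g (u x) \<le> indicator {x. h < u x} x + (u x)\<^sup>2"
    proof (cases "h < u x")
      case True
      then have "g (u x) \<le> \<bar>u x\<bar>" using h Fk by (auto simp: g_def)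
      moreover have "2 * \<bar>u x\<bar> \<le> 1 + (u x)\<^sup>2"
        using sum_squares_bound[of 1 "\<bar>u x\<bar>"] by simp
      ultimately show ?thesis using True by simp
    qed (use Fk in \<open>simp add: g_def\<close>)
    then have "ennreal (F * g (u x)) \<le> ennreal (F * (indicator {x. h < u x} x + (u x)\<^sup>2))"
      using F by (intro ennreal_leI mult_left_mono)
    also have "\<dots> = ennreal F * (indicator {x. h < u x} x + ennreal ((u x)\<^sup>2))"
      using F by (simp add: ennreal_mult ennreal_indicator)
    finally show "ennreal (F * g (u x)) \<le> \<dots>" .
  qed
  also have "\<dots> = ennreal F * (emeasure lebesgue {x. h < u x} + (\<integral>\<^sup>+x. ennreal ((u x)\<^sup>2) \<partial>lebesgue))"
    using A by (subst nn_integral_cmult) (auto simp: nn_integral_add)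
  also have "\<dots> < \<infinity>"
    using small H_J0_square_finite[OF u]
    by (auto simp: ennreal_mult_less_top intro: le_less_trans)
  finally have "(\<integral>\<^sup>+x. ennreal (\<kappa> * (g (u x))\<^sup>2) \<partial>lebesgue) = 0"
    using le2 by (auto simp: ennreal_add_left_cancel_le add.commute)
  then have "AE x in lebesgue. ennreal (\<kappa> * (g (u x))\<^sup>2) = 0"
    unfolding g_def by (subst (asm) nn_integral_0_iff_AE) auto
  then show ?thesis
  proof eventually_elim
    case (elim x)
    then have "g (u x) = 0"
      using \<kappa>_pos by (simp add: ennreal_eq_0_iff mult_le_0_iff)
    then show ?case by (simp add: g_def)
  qed
qed

section \<open>From the level estimates to full norms with one constant\<close>

definition W :: real where "W = measure lebesgue \<Omega>"

lemma W_nonneg: "W \<ge> 0"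
  by (simp add: W_def)

lemma emeasure_W: "emeasure lebesgue \<Omega> = ennreal W"
proof -
  have "\<Omega> \<in> lmeasurable"
    using \<Omega>_sets \<Omega>_bdd by (intro bounded_set_imp_lmeasurable)
  then show ?thesis
    unfolding W_def by (intro emeasure_eq_measure2) (auto simp: fmeasurable_def)
qed

text \<open>Integrating t^2 <= 1 + t^p for t = |f|/F replaces Hoelder's inequality and gives the
  factor W + 1 for every p at once.\<close>

lemma source_L2_le_of_Lp:
  assumes f: "set_borel_measurable lebesgue \<Omega> f" and p: "p \<ge> 2" and F: "F > 0"
    and le: "(\<integral>\<^sup>+x\<in>\<Omega>. ennreal (\<bar>f x\<bar> powr p) \<partial>lebesgue) \<le> ennreal (F powr p)"
  shows "(\<integral>\<^sup>+x\<in>\<Omega>. ennreal ((f x)\<^sup>2) \<partial>lebesgue) \<le> ennreal (F\<^sup>2 * (W + 1))"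
proof -
  have f_meas[measurable]: "(\<lambda>x. ennreal (\<bar>f x\<bar> powr p) * indicator \<Omega> x) \<in> borel_measurable lebesgue"
    using source_measurable[OF f, of "\<lambda>t. \<bar>t\<bar> powr p"] by simp
  note [measurable] = \<Omega>_sets
  have "(\<integral>\<^sup>+x\<in>\<Omega>. ennreal ((f x)\<^sup>2) \<partial>lebesgue)
    \<le> (\<integral>\<^sup>+x. ennreal (F\<^sup>2) * indicator \<Omega> x + ennreal (F\<^sup>2 / F powr p) * (ennreal (\<bar>f x\<bar> powr p) * indicator \<Omega> x) \<partial>lebesgue)"
  proof (intro nn_integral_mono)
    fix x
    define t where "t = \<bar>f x\<bar> / F"
    have t: "t \<ge> 0" "\<bar>f x\<bar> = F * t" using F by (auto simp: t_def)
    have "t\<^sup>2 \<le> 1 + t powr p"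
    proof (cases "t \<le> 1")
      case True
      then have "t\<^sup>2 \<le> 1" using t by (simp add: power_le_one)
      then show ?thesis by (simp add: add_increasing2)
    next
      case False
      then have "t powr 2 \<le> t powr p" using p by (intro powr_mono) auto
      then show ?thesis using False by (simp add: powr_numeral)
    qed
    then have "F\<^sup>2 * t\<^sup>2 \<le> F\<^sup>2 * (1 + t powr p)" by (intro mult_left_mono) auto
    also have "F\<^sup>2 * t\<^sup>2 = (f x)\<^sup>2"
      using t(2) by (metis power2_abs power_mult_distrib)
    also have "F\<^sup>2 * (1 + t powr p) = F\<^sup>2 * 1 + F\<^sup>2 / F powr p * \<bar>f x\<bar> powr p"
      using F by (simp add: t_def powr_divide distrib_left)
    finally have "ennreal ((f x)\<^sup>2) \<le> ennreal (F\<^sup>2 * 1 + F\<^sup>2 / F powr p * \<bar>f x\<bar> powr p)"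
      by (rule ennreal_leI)
    also have "\<dots> = ennreal (F\<^sup>2) + ennreal (F\<^sup>2 / F powr p) * ennreal (\<bar>f x\<bar> powr p)"
      using F by (subst ennreal_linear_combination) auto
    finally show "ennreal ((f x)\<^sup>2) * indicator \<Omega> x
      \<le> ennreal (F\<^sup>2) * indicator \<Omega> x + ennreal (F\<^sup>2 / F powr p) * (ennreal (\<bar>f x\<bar> powr p) * indicator \<Omega> x)"
      by (auto simp: indicator_def)
  qed
  also have "\<dots> = ennreal (F\<^sup>2) * ennreal W
      + ennreal (F\<^sup>2 / F powr p) * (\<integral>\<^sup>+x\<in>\<Omega>. ennreal (\<bar>f x\<bar> powr p) \<partial>lebesgue)"
    using \<Omega>_sets by (subst nn_integral_add) (auto simp: nn_integral_cmult nn_integral_cmult_indicator emeasure_W)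
  also have "\<dots> \<le> ennreal (F\<^sup>2) * ennreal W + ennreal (F\<^sup>2 / F powr p) * ennreal (F powr p)"
    by (intro add_left_mono mult_left_mono le) simp
  also have "\<dots> = ennreal (F\<^sup>2 * W + F\<^sup>2 / F powr p * F powr p)"
    using F W_nonneg by (subst ennreal_linear_combination) auto
  also have "F\<^sup>2 * W + F\<^sup>2 / F powr p * F powr p = F\<^sup>2 * (W + 1)"
    using F by (simp add: distrib_left)
  finally show ?thesis .
qed

text \<open>By homogeneity the level may be taken as A F, with A determined by P, W and V alone and
  hence independent of p, f and u.\<close>

lemma superlevel_small_of_L2:
  assumes sol: "weak_solution J \<Omega> f u" and f: "set_borel_measurable lebesgue \<Omega> f"
    and P: "P > 0" "\<And>u. u \<in> H_J0 J \<Omega> \<Longrightarrow> (\<integral>\<^sup>+x. ennreal ((u x)\<^sup>2) \<partial>lebesgue) \<le> ennreal P * energy_nn J \<Omega> u"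
    and L2: "(\<integral>\<^sup>+x\<in>\<Omega>. ennreal ((f x)\<^sup>2) \<partial>lebesgue) \<le> ennreal (F\<^sup>2 * (W + 1))"
    and F: "F > 0" and A: "A > 0" "P\<^sup>2 * (W + 1) \<le> A\<^sup>2 * V / 2"
  shows "emeasure lebesgue {x. A * F < u x} \<le> ennreal (V/2)"
proof (rule superlevel_small)
  show "u \<in> borel_measurable lebesgue"
    using sol H_J0_measurable by (simp add: weak_solution_def)
  have "(\<integral>\<^sup>+x. ennreal ((u x)\<^sup>2) \<partial>lebesgue) \<le> ennreal (P\<^sup>2) * ennreal (F\<^sup>2 * (W + 1))"
    by (rule order_trans[OF weak_solution_L2_bound[OF sol f P] mult_left_mono[OF L2]]) auto
  also have "\<dots> = ennreal (P\<^sup>2 * (F\<^sup>2 * (W + 1)))"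
    using W_nonneg by (intro ennreal_mult[symmetric]) auto
  finally show "(\<integral>\<^sup>+x. ennreal ((u x)\<^sup>2) \<partial>lebesgue) \<le> ennreal (P\<^sup>2 * (F\<^sup>2 * (W + 1)))" .
  show "P\<^sup>2 * (F\<^sup>2 * (W + 1)) \<le> (A * F)\<^sup>2 * V / 2"
    using mult_left_mono[OF A(2), of "F\<^sup>2"] by (simp add: power_mult_distrib mult_ac)
qed (use A F in auto)

lemma Lp_estimate_finite:
  assumes sol: "weak_solution J \<Omega> f u" and f: "set_borel_measurable lebesgue \<Omega> f"
    and p: "p \<ge> 2" and F: "F > 0"
    and le: "(\<integral>\<^sup>+x\<in>\<Omega>. ennreal (\<bar>f x\<bar> powr p) \<partial>lebesgue) \<le> ennreal (F powr p)"
    and A: "A > 0" and D: "A \<le> D" "2 / \<kappa> \<le> D"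
    and small: "emeasure lebesgue {x. A * F < u x} \<le> ennreal (V/2)"
      "emeasure lebesgue {x. A * F < - u x} \<le> ennreal (V/2)"
  shows "(\<integral>\<^sup>+x\<in>\<Omega>. ennreal (\<bar>u x\<bar> powr p) \<partial>lebesgue) \<le> ennreal ((2 * D * (W + 2) * F) powr p)"
proof -
  have [measurable]: "u \<in> borel_measurable lebesgue"
    using sol H_J0_measurable by (simp add: weak_solution_def)
  note [measurable] = \<Omega>_sets
  define h where "h = A * F"
  have h: "h \<ge> 0" unfolding h_def using A F by simp
  have D0: "D > 0" using A D by simp
  let ?v = "\<lambda>x. max 0 (u x - h)" and ?w = "\<lambda>x. max 0 (- u x - h)"
  have v: "(\<integral>\<^sup>+x. ennreal (?v x powr p) \<partial>lebesgue) \<le> ennreal ((D * F) powr p)" (is ?g1)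
    and w: "(\<integral>\<^sup>+x. ennreal (?w x powr p) \<partial>lebesgue) \<le> ennreal ((D * F) powr p)" (is ?g2)
  proof -
    have "ennreal ((2 / \<kappa>) powr p) * (\<integral>\<^sup>+x\<in>\<Omega>. ennreal (\<bar>f x\<bar> powr p) \<partial>lebesgue) \<le> ennreal (D powr p) * ennreal (F powr p)"
      using D \<kappa>_pos p by (intro mult_mono le ennreal_leI powr_mono2) auto
    also have "\<dots> = ennreal ((D * F) powr p)"
      using D0 F by (simp add: ennreal_mult[symmetric] powr_mult)
    finally have *: "ennreal ((2 / \<kappa>) powr p) * (\<integral>\<^sup>+x\<in>\<Omega>. ennreal (\<bar>f x\<bar> powr p) \<partial>lebesgue) \<le> ennreal ((D * F) powr p)" .
    have f': "set_borel_measurable lebesgue \<Omega> (\<lambda>x. - f x)"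
      using f unfolding set_borel_measurable_def by simp
    show ?g1
      using power_bound_above_level[OF sol f p h] small(1) * unfolding h_def by (meson order_trans)
    show ?g2
      using power_bound_above_level[OF weak_solution_uminus[OF sol] f' p h] small(2) *
      unfolding h_def abs_minus_cancel by (meson order_trans)
  qed
  have "(\<integral>\<^sup>+x\<in>\<Omega>. ennreal (\<bar>u x\<bar> powr p) \<partial>lebesgue)
     \<le> (\<integral>\<^sup>+x. ennreal ((2 * D * F) powr p) * indicator \<Omega> x
        + (ennreal (2 powr p) * ennreal (?v x powr p) + ennreal (2 powr p) * ennreal (?w x powr p)) \<partial>lebesgue)"
  proof (intro nn_integral_mono)
    fix x
    have "\<bar>u x\<bar> powr p \<le> (2 * D * F) powr p + (2 powr p * ?v x powr p + 2 powr p * ?w x powr p)"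
    proof (cases "\<bar>u x\<bar> \<le> 2 * h")
      case True
      also have "2 * h \<le> 2 * D * F" unfolding h_def using D F by simp
      finally have "\<bar>u x\<bar> powr p \<le> (2 * D * F) powr p"
        using p by (intro powr_mono2) auto
      then show ?thesis by (simp add: add_increasing2)
    next
      case False
      \<comment> \<open>If |u| > 2h, subtracting h removes less than half of |u|.\<close>
      then have "\<bar>u x\<bar> \<le> 2 * max (?v x) (?w x)" using h by (auto simp: max_def abs_if split: if_splits)
      then have "\<bar>u x\<bar> powr p \<le> (2 * max (?v x) (?w x)) powr p"
        using p by (intro powr_mono2) auto
      also have "\<dots> = 2 powr p * max (?v x) (?w x) powr p"
        by (rule powr_mult)
      also have "\<dots> \<le> 2 powr p * (?v x powr p + ?w x powr p)"
        by (intro mult_left_mono) (auto simp: max_def)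
      finally show ?thesis by (simp add: distrib_left add_increasing)
    qed
    then have "ennreal (\<bar>u x\<bar> powr p) \<le> ennreal ((2 * D * F) powr p + (2 powr p * ?v x powr p + 2 powr p * ?w x powr p))"
      by (rule ennreal_leI)
    also have "\<dots> = ennreal ((2 * D * F) powr p)
        + (ennreal (2 powr p) * ennreal (?v x powr p) + ennreal (2 powr p) * ennreal (?w x powr p))"
      by (simp add: ennreal_mult)
    finally show "ennreal (\<bar>u x\<bar> powr p) * indicator \<Omega> x \<le> ennreal ((2 * D * F) powr p) * indicator \<Omega> x
        + (ennreal (2 powr p) * ennreal (?v x powr p) + ennreal (2 powr p) * ennreal (?w x powr p))"
      by (auto simp: indicator_def)
  qed
  also have "\<dots> = ennreal ((2 * D * F) powr p) * ennreal W
      + (ennreal (2 powr p) * (\<integral>\<^sup>+x. ennreal (?v x powr p) \<partial>lebesgue)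
        + ennreal (2 powr p) * (\<integral>\<^sup>+x. ennreal (?w x powr p) \<partial>lebesgue))"
    using \<Omega>_sets by (simp add: nn_integral_add nn_integral_cmult nn_integral_cmult_indicator emeasure_W)
  also have "\<dots> \<le> ennreal ((2 * D * F) powr p) * ennreal W
      + (ennreal (2 powr p) * ennreal ((D * F) powr p) + ennreal (2 powr p) * ennreal ((D * F) powr p))"
    by (intro add_left_mono add_mono mult_left_mono v w) auto
  also have "\<dots> = ennreal ((2 * D * F) powr p * (W + 2))"
  proof -
    have "2 powr p * (D * F) powr p = (2 * D * F) powr p"
      using D0 F by (simp add: powr_mult mult.assoc)
    then have "ennreal (2 powr p) * ennreal ((D * F) powr p) = ennreal ((2 * D * F) powr p)"
      by (simp add: ennreal_mult[symmetric])
    then show ?thesis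
      using W_nonneg by (simp add: distrib_left ennreal_mult[symmetric] ennreal_plus[symmetric] del: ennreal_plus)
  qed
  also have "\<dots> \<le> ennreal ((2 * D * (W + 2) * F) powr p)"
  proof (rule ennreal_leI)
    \<comment> \<open>Since W + 2 >= 1, the measure factor is dominated by its own p-th power and so
      leaves the p-th root with a bound free of p.\<close>
    have "(W + 2) powr 1 \<le> (W + 2) powr p"
      using W_nonneg p by (intro powr_mono) auto
    then have "(2 * D * F) powr p * (W + 2) \<le> (2 * D * F) powr p * (W + 2) powr p"
      using W_nonneg by (intro mult_left_mono) auto
    also have "\<dots> = (2 * D * F * (W + 2)) powr p"
      by (rule powr_mult[symmetric])
    finally show "(2 * D * F) powr p * (W + 2) \<le> (2 * D * (W + 2) * F) powr p"
      by (simp add: mult_ac)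
  qed
  finally show ?thesis .
qed

lemma Linfinity_estimate:
  assumes sol: "weak_solution J \<Omega> f u" and F: "F > 0"
    and bound: "AE x in lebesgue. x \<in> \<Omega> \<longrightarrow> \<bar>f x\<bar> \<le> F"
    and A: "A > 0" and D: "A \<le> D" "2 / \<kappa> \<le> D"
    and small: "emeasure lebesgue {x. A * F < u x} \<le> ennreal (V/2)"
      "emeasure lebesgue {x. A * F < - u x} \<le> ennreal (V/2)"
  shows "AE x in lebesgue. \<bar>u x\<bar> \<le> 2 * D * (W + 2) * F"
proof -
  have AF: "A * F \<ge> 0" using A F by simp
  have F0: "F \<ge> 0" using F by simp
  \<comment> \<open>The sharper constant A + 1/\<kappa> is enlarged to the one of the finite case,
    so that a single C covers all exponents.\<close>
  have "1 / \<kappa> \<le> 2 / \<kappa>" using \<kappa>_pos by (simp add: divide_right_mono)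
  then have "(A + 1 / \<kappa>) * F \<le> (2 * D) * F"
    using D F by (intro mult_right_mono) auto
  also have "\<dots> \<le> 2 * D * (W + 2) * F"
    using W_nonneg A D F by (intro mult_right_mono) (auto simp: distrib_left)
  finally have le: "A * F + F / \<kappa> \<le> 2 * D * (W + 2) * F"
    by (simp add: distrib_right)
  have "AE x in lebesgue. u x \<le> A * F + F / \<kappa>"
    by (rule upper_bound_above_level[OF sol F0 bound AF small(1)])
  moreover have "AE x in lebesgue. - u x \<le> A * F + F / \<kappa>"
    using bound by (intro upper_bound_above_level[OF weak_solution_uminus[OF sol] F0 _ AF small(2)]) simp
  ultimately show ?thesis
    by eventually_elim (use le in linarith)
qed

text \<open>Strictness produces an actual essential bound below F, so there is no need to show that
  the infimum is attained.\<close>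

lemma Lp_infinity_less_imp_AE_bound:
  assumes "Lp_norm \<Omega> \<infinity> f < ennreal F"
  shows "AE x in lebesgue. x \<in> \<Omega> \<longrightarrow> \<bar>f x\<bar> \<le> F"
proof -
  obtain C where C: "AE x in lebesgue. x \<in> \<Omega> \<longrightarrow> ennreal \<bar>f x\<bar> \<le> C" "C < ennreal F"
    using assms unfolding Lp_norm_def by (auto simp: Inf_less_iff)
  from C(1) show ?thesis
  proof eventually_elim
    case (elim x)
    show ?case
    proof
      assume "x \<in> \<Omega>"
      with elim C(2) have "ennreal \<bar>f x\<bar> < ennreal F" by (meson le_less_trans)
      then show "\<bar>f x\<bar> \<le> F" by (simp add: ennreal_less_iff)
    qed
  qed
qed

theorem uniform_Lp_estimate:
  obtains C :: real where "C > 0"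
    "\<And>p f u. 2 \<le> p \<Longrightarrow> in_Lp \<Omega> p f \<Longrightarrow> weak_solution J \<Omega> f u \<Longrightarrow> Lp_norm \<Omega> p u \<le> ennreal C * Lp_norm \<Omega> p f"
proof -
  obtain P where P: "P > 0"
    "\<And>u. u \<in> H_J0 J \<Omega> \<Longrightarrow> (\<integral>\<^sup>+x. ennreal ((u x)\<^sup>2) \<partial>lebesgue) \<le> ennreal P * energy_nn J \<Omega> u"
    using Poincare_inequality by blast
  \<comment> \<open>The added 1 ensures A <= A^2, so the quadratic requirement on A follows from a
    linear one and no square root is needed.\<close>
  define A where "A = 2 * (P\<^sup>2 * (W + 1)) / V + 1"
  have "2 * (P\<^sup>2 * (W + 1)) / V \<ge> 0" using W_nonneg V_pos by simp
  then have A: "A \<ge> 1" unfolding A_def by simp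
  have A2: "P\<^sup>2 * (W + 1) \<le> A\<^sup>2 * V / 2"
  proof -
    have "2 * (P\<^sup>2 * (W + 1)) / V \<le> A" by (simp add: A_def)
    also have "A \<le> A\<^sup>2" using A by (simp add: power2_eq_square)
    finally show ?thesis using V_pos by (simp add: field_simps)
  qed
  define D where "D = max A (2 / \<kappa>)"
  define C where "C = 2 * D * (W + 2)"
  have D: "A \<le> D" "2 / \<kappa> \<le> D" "D > 0" using A by (auto simp: D_def)
  have C: "C > 0" using D W_nonneg by (simp add: C_def)
  have A0: "A > 0" using A by simp
  moreover have "Lp_norm \<Omega> p u \<le> ennreal C * Lp_norm \<Omega> p f"
    if p: "2 \<le> p" and f: "in_Lp \<Omega> p f" and sol: "weak_solution J \<Omega> f u" for p f u
  proof -
    have f_meas: "set_borel_measurable lebesgue \<Omega> f" using f by (simp add: in_Lp_def)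
    have f_meas': "set_borel_measurable lebesgue \<Omega> (\<lambda>x. - f x)"
      using f_meas unfolding set_borel_measurable_def by simp
    obtain N where N: "Lp_norm \<Omega> p f = ennreal N" "N \<ge> 0"
      using f by (cases "Lp_norm \<Omega> p f") (auto simp: in_Lp_def)
    \<comment> \<open>Working with F strictly above the norm N keeps F positive even when f = 0
      almost everywhere; F = N + e/C then recovers N itself as e tends to 0.\<close>
    have main: "Lp_norm \<Omega> p u \<le> ennreal (C * F)" if NF: "N < F" for F
    proof -
      have F: "F > 0" using N NF by simp
      have small: "emeasure lebesgue {x. A * F < u x} \<le> ennreal (V/2)"
          "emeasure lebesgue {x. A * F < - u x} \<le> ennreal (V/2)"
        if "(\<integral>\<^sup>+x\<in>\<Omega>. ennreal ((f x)\<^sup>2) \<partial>lebesgue) \<le> ennreal (F\<^sup>2 * (W + 1))"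
        using superlevel_small_of_L2[OF sol f_meas P _ F A0 A2]
          superlevel_small_of_L2[OF weak_solution_uminus[OF sol] f_meas' P _ F A0 A2] that
        by simp_all
      show ?thesis
      proof (cases "p = \<infinity>")
        case True
        then have bound: "AE x in lebesgue. x \<in> \<Omega> \<longrightarrow> \<bar>f x\<bar> \<le> F"
          using N NF by (intro Lp_infinity_less_imp_AE_bound) (simp add: ennreal_less_iff)
        have "(\<integral>\<^sup>+x\<in>\<Omega>. ennreal ((f x)\<^sup>2) \<partial>lebesgue) \<le> (\<integral>\<^sup>+x. ennreal (F\<^sup>2) * indicator \<Omega> x \<partial>lebesgue)"
          using bound
        proof (intro nn_integral_mono_AE, eventually_elim)
          case (elim x)
          then show ?case
            using abs_le_square_iff[of "f x" F] F by (auto simp: indicator_def intro!: ennreal_leI)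
        qed
        also have "\<dots> = ennreal (F\<^sup>2 * W)"
          using \<Omega>_sets W_nonneg by (simp add: nn_integral_cmult_indicator emeasure_W ennreal_mult)
        also have "\<dots> \<le> ennreal (F\<^sup>2 * (W + 1))"
          by (intro ennreal_leI mult_left_mono) auto
        finally have "AE x in lebesgue. \<bar>u x\<bar> \<le> C * F"
          unfolding C_def using small by (intro Linfinity_estimate[OF sol F bound A0 D(1,2)])
        then have "AE x in lebesgue. x \<in> \<Omega> \<longrightarrow> ennreal \<bar>u x\<bar> \<le> ennreal (C * F)"
          by eventually_elim (simp add: ennreal_leI)
        then show ?thesis
          unfolding Lp_norm_def using True by (auto intro!: Inf_lower)
      next
        case False
        then obtain q where q: "p = ennreal q" "q \<ge> 0" by (cases p) auto
        then have q2: "q \<ge> 2" using p by (simp flip: ennreal_numeral)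
        then have p1: "1 \<le> p" using q by (simp flip: ennreal_1)
        have pq: "enn2real p = q" using q by simp
        have le: "(\<integral>\<^sup>+x\<in>\<Omega>. ennreal (\<bar>f x\<bar> powr q) \<partial>lebesgue) \<le> ennreal (F powr q)"
          using Lp_norm_le_iff[OF False p1 F, of \<Omega> f] N NF by (simp add: pq ennreal_leI)
        have "(\<integral>\<^sup>+x\<in>\<Omega>. ennreal (\<bar>u x\<bar> powr q) \<partial>lebesgue) \<le> ennreal ((C * F) powr q)"
          unfolding C_def using small[OF source_L2_le_of_Lp[OF f_meas q2 F le]]
          by (intro Lp_estimate_finite[OF sol f_meas q2 F le A0 D(1,2)])
        then show ?thesis
          using Lp_norm_le_iff[OF False p1, of "C * F" \<Omega> u] C F by (simp add: pq)
      qed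
    qed
    show ?thesis
    proof (rule ennreal_le_epsilon)
      fix e :: real
      assume e: "0 < e"
      have "Lp_norm \<Omega> p u \<le> ennreal (C * (N + e / C))"
        using e C by (intro main) simp
      also have "C * (N + e / C) = C * N + e"
        using C by (simp add: distrib_left)
      finally show "Lp_norm \<Omega> p u \<le> ennreal C * Lp_norm \<Omega> p f + ennreal e"
        using N C e by (simp add: ennreal_mult)
    qed
  qed
  ultimately show thesis using C that by blast
qed

end

section \<open>Finding the ball of displacements for the given kernel\<close>

theorem mainTheorem15:
  fixes J :: "'n::euclidean_space \<Rightarrow> 'n \<Rightarrow> real"
    and \<Omega> :: "'n set"
    and K :: "'n \<Rightarrow> real"
    and ell :: "real \<Rightarrow> real"
    and \<rho> :: real
  assumes \<Omega>_open: "open \<Omega>" and \<Omega>_bdd: "bounded \<Omega>"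
    and J_meas: "(\<lambda>w. J (fst w) (snd w)) \<in> borel_measurable (lebesgue \<Otimes>\<^sub>M lebesgue)"
    and J_nonneg: "\<And>x y. J x y \<ge> 0"
    and J_sym: "\<And>x y. J x y = J y x"
    and J_levy: "\<exists>B::real. \<forall>x. (\<integral>\<^sup>+ y. ennreal (min 1 ((norm (x - y))^2) * J x y) \<partial>lebesgue) \<le> ennreal B"
    and J_ge_K: "\<And>x y. J x y \<ge> K (x - y)"
    and K_nonneg: "\<And>z. K z \<ge> 0"
    and K_not_L1: "\<And>\<epsilon>. \<epsilon> > 0 \<Longrightarrow> \<not> set_integrable lebesgue (ball 0 \<epsilon>) K"
    and \<rho>_pos: "\<rho> > 0"
    and ell_pos: "\<And>s. 0 < s \<Longrightarrow> s < \<rho> \<Longrightarrow> ell s > 0"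
    and ell_bounds: "\<And>\<epsilon>. 0 < \<epsilon> \<Longrightarrow> \<epsilon> < \<rho> \<Longrightarrow>
        \<exists>c1 c2. 0 < c1 \<and> 0 < c2 \<and> (\<forall>s. \<epsilon> \<le> s \<and> s < \<rho> \<longrightarrow> c1 \<le> ell s \<and> ell s \<le> c2)"
    and K_form: "\<And>z. 0 < norm z \<Longrightarrow> norm z < \<rho> \<Longrightarrow>
        K z = norm z powr (- real DIM('n)) * ell (norm z)"
    and M_infty: "((\<lambda>r. \<integral>\<^sup>+ s\<in>{r..\<rho>}. ennreal (ell s / s) \<partial>lborel) \<longlongrightarrow> \<infinity>) (at_right 0)"
    and ell_slow: "\<And>lam. lam > 0 \<Longrightarrow> ((\<lambda>s. ell (lam * s) / ell s) \<longlongrightarrow> 1) (at_right 0)"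
  shows "\<exists>C::real. \<forall>p::ennreal. \<forall>f u. 2 \<le> p \<longrightarrow> in_Lp \<Omega> p f \<longrightarrow> weak_solution J \<Omega> f u
           \<longrightarrow> Lp_norm \<Omega> p u \<le> ennreal C * Lp_norm \<Omega> p f"
proof -
  obtain b :: 'n where b: "b \<in> Basis" using nonempty_Basis by blast
  obtain c1 where c1: "0 < c1" "\<And>s. \<rho> / 4 \<le> s \<Longrightarrow> s < \<rho> \<Longrightarrow> c1 \<le> ell s"
    using ell_bounds[of "\<rho> / 4"] \<rho>_pos by auto
  \<comment> \<open>A displacement shorter than \<rho> satisfies |z|^(-N) >= \<rho>^(-N), and
    \<open>c1\<close> bounds \<open>ell\<close> below on [\<rho>/4, \<rho>).\<close>
  define c\<^sub>0 where "c\<^sub>0 = \<rho> powr (- real DIM('n)) * c1"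
  \<comment> \<open>The ball of radius \<rho>/4 about a vector of length \<rho>/2 lies in the
    annulus \<rho>/4 < |z| < 3\<rho>/4. There \<open>K\<close> is radial, so replacing y - x by x -
    y is harmless.\<close>
  have "kernel_bounded_below J \<Omega> c\<^sub>0 ((\<rho> / 2) *\<^sub>R b) (\<rho> / 4)"
  proof
    fix x y :: 'n
    assume "y - x \<in> ball ((\<rho> / 2) *\<^sub>R b) (\<rho> / 4)"
    then have d: "norm ((\<rho> / 2) *\<^sub>R b - (y - x)) < \<rho> / 4" by (simp add: dist_norm)
    have nb: "norm ((\<rho> / 2) *\<^sub>R b) = \<rho> / 2" using b \<rho>_pos by simp
    have "norm (x - y) = norm (y - x)" by (rule norm_minus_commute)
    then have n: "\<rho> / 4 \<le> norm (x - y)" "norm (x - y) < \<rho>"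
      using d nb norm_triangle_ineq2[of "(\<rho> / 2) *\<^sub>R b" "y - x"]
        norm_triangle_ineq3[of "(\<rho> / 2) *\<^sub>R b" "y - x"] \<rho>_pos by linarith+
    have "c\<^sub>0 \<le> norm (x - y) powr (- real DIM('n)) * ell (norm (x - y))"
      unfolding c\<^sub>0_def using n c1 \<rho>_pos
      by (intro mult_mono powr_mono2') auto
    also have "\<dots> = K (x - y)"
      using n \<rho>_pos by (intro K_form[symmetric]) auto
    finally show "c\<^sub>0 \<le> J x y" using J_ge_K by (meson order_trans)
  qed (use \<Omega>_open \<Omega>_bdd J_meas J_nonneg c1 \<rho>_pos b in \<open>auto simp: c\<^sub>0_def\<close>)
  then interpret kernel_bounded_below J \<Omega> c\<^sub>0 "(\<rho> / 2) *\<^sub>R b" "\<rho> / 4" .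
  show ?thesis using uniform_Lp_estimate by metis
qed

end
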